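(* (i) For every $n \ge 0$, the $\mathbb{Z}$-valued $2$-cocycles for the Laver table $A_n$ make a free $\mathbb{Z}$-module of rank $2^n$, with a basis consisting of the constant cocycle and of $2^n-1$ explicit $\{0,1\}$-valued coboundaries defined for $1 \le q < 2^n$ by $$\psi_{q,n}(x,y) = \begin{cases} 1 & \text{if } q \text{ can be written as } p \triangleright_n y \text{ for some } p, \text{ but not as } r \triangleright_n (x \triangleright_n y),\\ 0 & \text{otherwise.}\end{cases}$$ (ii) For every $n \ge 0$, the $\mathbb{Z}$-valued $3$-cocycles for $A_n$ make a free $\mathbb{Z}$-module of rank $2^{2n}-2^n+1$, with a basis consisting of the constant cocycle and of $2^{2n}-2^n$ explicit $\{0,\pm 1\}$-valued coboundaries indexed by pairs $(p,q)$ with $1 \le p,q \le 2^n$ and $p \ne 2^n-1$.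
   Context: For $n \ge 0$, the $n$th Laver table is the set $A_n = \{1,\dots,2^n\}$ equipped with the unique binary operation $\triangleright_n$ such that, for all $x,y$, $x \triangleright_n 1 = (x+1) \bmod 2^n$ and $x \triangleright_n (y \triangleright_n 1) = (x \triangleright_n y) \triangleright_n (x \triangleright_n 1)$, where $a \bmod m$ denotes the unique integer in $\{1,\dots,m\}$ congruent to $a$ modulo $m$. (By a known theorem of Laver this operation exists, is unique, and satisfies the left-selfdistributivity law $x \triangleright (y \triangleright z) = (x \triangleright y) \triangleright (x \triangleright z)$.) Write $\triangleright$ for $\triangleright_n$. In (i), $p$ and $r$ range over $A_n$. A ($\mathbb{Z}$-valued, rack) $2$-cocycle for $A_n$ is a map $\phi: A_n^2 \to \mathbb{Z}$ satisfying for all $x,y,z$: $\phi(x \triangleright y, x \triangleright z) + \phi(x,z) = \phi(x, y\triangleright z) + \phi(y,z)$. A $2$-coboundary is a map of the form $(x,y) \mapsto \theta(x \triangleright y) - \theta(y)$ with $\theta: A_n \to \mathbb{Z}$. A $3$-cocycle for $A_n$ is a map $\phi: A_n^3 \to \mathbb{Z}$ satisfying for all $x,y,z,t$: $\phi(x \triangleright y, x \triangleright z, x \triangleright t) + \phi(x,y,z \triangleright t) + \phi(x,z,t) = \phi(x, y \triangleright z, y \triangleright t) + \phi(y,z,t) + \phi(x,y,t)$. A $3$-coboundary is a map of the form $(x,y,z) \mapsto \theta(x \triangleright y, x \triangleright z) + \theta(x,z) - \theta(x, y \triangleright z) - \theta(y,z)$ with $\theta: A_n^2 \to \mathbb{Z}$.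 The constant cocycle is the constant map with value $1$. "$\{0,1\}$-valued" and "$\{0,\pm1\}$-valued" refer to the values on $A_n^2$ and $A_n^3$ respectively.
   Formalization: In (ii), the excluded value 2^n−1 is read as a residue in {1,…,2^n}; this changes only n = 0, where the literal index set {(1,1)} contradicts the stated count 0 and the formal index set is empty. The explicit coboundaries are those of the indicator functions of the pairs (p,q). *)

theory Defs
  imports Complex_Main "HOL-Library.Function_Algebras" "HOL-Library.Indicator_Function"
begin

definition laver_set :: "nat \<Rightarrow> nat set" where
  "laver_set n = {1..2 ^ n}"

text \<open>Residues are taken in \<open>{1..m}\<close> rather than in \<open>{0..<m}\<close>.\<close>

definition pmod :: "nat \<Rightarrow> nat \<Rightarrow> nat" where
  "pmod a m = (if a mod m = 0 then m else a mod m)"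

lemma pmod_unique:
  assumes "m > 0"
  shows "r = pmod a m \<longleftrightarrow> r \<in> {1..m} \<and> r mod m = a mod m"
proof
  assume "r = pmod a m"
  then show "r \<in> {1..m} \<and> r mod m = a mod m"
    using assms by (auto simp: pmod_def Suc_le_eq less_imp_le)
next
  assume r: "r \<in> {1..m} \<and> r mod m = a mod m"
  then show "r = pmod a m"
    by (cases "r = m") (auto simp: pmod_def)
qed

definition laver_table :: "nat \<Rightarrow> (nat \<Rightarrow> nat \<Rightarrow> nat) \<Rightarrow> bool" where
  "laver_table n lop \<longleftrightarrow>
     (\<forall>x\<in>laver_set n. \<forall>y\<in>laver_set n. lop x y \<in> laver_set n) \<and>
     (\<forall>x\<in>laver_set n. lop x 1 = pmod (x + 1) (2 ^ n)) \<and>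
     (\<forall>x\<in>laver_set n. \<forall>y\<in>laver_set n. lop x (lop y 1) = lop (lop x y) (lop x 1))"

text \<open>A map \<open>S \<rightarrow> \<int>\<close> is represented by the function on the whole type that agrees with it
  on \<open>S\<close> and vanishes outside \<open>S\<close>, so that distinct maps have distinct representatives and
  the representatives are closed under pointwise operations.\<close>

definition zmaps :: "'a set \<Rightarrow> ('a \<Rightarrow> int) set" where
  "zmaps S = {f. \<forall>z. z \<notin> S \<longrightarrow> f z = 0}"

definition zmap_on :: "'a set \<Rightarrow> ('a \<Rightarrow> int) \<Rightarrow> 'a \<Rightarrow> int" where
  "zmap_on S f = (\<lambda>z. if z \<in> S then f z else 0)"

definition zscale :: "int \<Rightarrow> ('a \<Rightarrow> int) \<Rightarrow> 'a \<Rightarrow> int" where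
  "zscale c f = (\<lambda>z. c * f z)"

global_interpretation zmod: module "zscale :: int \<Rightarrow> ('a \<Rightarrow> int) \<Rightarrow> 'a \<Rightarrow> int"
  by unfold_locales (auto simp: zscale_def fun_eq_iff algebra_simps)

definition zbasis :: "('a \<Rightarrow> int) set \<Rightarrow> ('a \<Rightarrow> int) set \<Rightarrow> bool" where
  "zbasis M B \<longleftrightarrow> zmod.subspace M \<and> zmod.independent B \<and> zmod.span B = M"

definition zfree_of_rank :: "('a \<Rightarrow> int) set \<Rightarrow> nat \<Rightarrow> bool" where
  "zfree_of_rank M r \<longleftrightarrow> (\<exists>B. zbasis M B \<and> finite B \<and> card B = r)"

abbreviation laver_pairs :: "nat \<Rightarrow> (nat \<times> nat) set" where
  "laver_pairs n \<equiv> laver_set n \<times> laver_set n"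

abbreviation laver_triples :: "nat \<Rightarrow> (nat \<times> nat \<times> nat) set" where
  "laver_triples n \<equiv> laver_set n \<times> laver_set n \<times> laver_set n"

definition cocycles2 :: "nat \<Rightarrow> (nat \<Rightarrow> nat \<Rightarrow> nat) \<Rightarrow> (nat \<times> nat \<Rightarrow> int) set" where
  "cocycles2 n lop = {\<phi> \<in> zmaps (laver_pairs n).
     \<forall>x\<in>laver_set n. \<forall>y\<in>laver_set n. \<forall>z\<in>laver_set n.
       \<phi> (lop x y, lop x z) + \<phi> (x, z) = \<phi> (x, lop y z) + \<phi> (y, z)}"

definition cobound2 :: "nat \<Rightarrow> (nat \<Rightarrow> nat \<Rightarrow> nat) \<Rightarrow> (nat \<Rightarrow> int) \<Rightarrow> nat \<times> nat \<Rightarrow> int" where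
  "cobound2 n lop \<theta> = zmap_on (laver_pairs n) (\<lambda>(x, y). \<theta> (lop x y) - \<theta> y)"

definition coboundaries2 :: "nat \<Rightarrow> (nat \<Rightarrow> nat \<Rightarrow> nat) \<Rightarrow> (nat \<times> nat \<Rightarrow> int) set" where
  "coboundaries2 n lop = {cobound2 n lop \<theta> | \<theta>. \<theta> \<in> zmaps (laver_set n)}"

definition cocycles3 :: "nat \<Rightarrow> (nat \<Rightarrow> nat \<Rightarrow> nat) \<Rightarrow> (nat \<times> nat \<times> nat \<Rightarrow> int) set" where
  "cocycles3 n lop = {\<phi> \<in> zmaps (laver_triples n).
     \<forall>x\<in>laver_set n. \<forall>y\<in>laver_set n. \<forall>z\<in>laver_set n. \<forall>t\<in>laver_set n.
       \<phi> (lop x y, lop x z, lop x t) + \<phi> (x, y, lop z t) + \<phi> (x, z, t) =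
       \<phi> (x, lop y z, lop y t) + \<phi> (y, z, t) + \<phi> (x, y, t)}"

definition cobound3 ::
    "nat \<Rightarrow> (nat \<Rightarrow> nat \<Rightarrow> nat) \<Rightarrow> (nat \<times> nat \<Rightarrow> int) \<Rightarrow> nat \<times> nat \<times> nat \<Rightarrow> int" where
  "cobound3 n lop \<theta> = zmap_on (laver_triples n)
     (\<lambda>(x, y, z). \<theta> (lop x y, lop x z) + \<theta> (x, z) - \<theta> (x, lop y z) - \<theta> (y, z))"

definition coboundaries3 :: "nat \<Rightarrow> (nat \<Rightarrow> nat \<Rightarrow> nat) \<Rightarrow> (nat \<times> nat \<times> nat \<Rightarrow> int) set" where
  "coboundaries3 n lop = {cobound3 n lop \<theta> | \<theta>. \<theta> \<in> zmaps (laver_pairs n)}"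

definition const2 :: "nat \<Rightarrow> nat \<times> nat \<Rightarrow> int" where
  "const2 n = zmap_on (laver_pairs n) (\<lambda>_. 1)"

definition const3 :: "nat \<Rightarrow> nat \<times> nat \<times> nat \<Rightarrow> int" where
  "const3 n = zmap_on (laver_triples n) (\<lambda>_. 1)"

definition psi :: "nat \<Rightarrow> (nat \<Rightarrow> nat \<Rightarrow> nat) \<Rightarrow> nat \<Rightarrow> nat \<times> nat \<Rightarrow> int" where
  "psi n lop q = zmap_on (laver_pairs n)
     (\<lambda>(x, y). if (\<exists>p\<in>laver_set n. q = lop p y) \<and> \<not> (\<exists>r\<in>laver_set n. q = lop r (lop x y))
               then 1 else 0)"

text \<open>The explicit 3-coboundaries are the coboundaries of the indicator functions of
  single pairs \<open>(p, q)\<close>.\<close>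

definition phi3 :: "nat \<Rightarrow> (nat \<Rightarrow> nat \<Rightarrow> nat) \<Rightarrow> nat \<times> nat \<Rightarrow> nat \<times> nat \<times> nat \<Rightarrow> int" where
  "phi3 n lop pq = cobound3 n lop (indicator {pq})"

text \<open>The excluded first coordinate is \<open>2 ^ n - 1\<close> read as an element of \<open>{1..2 ^ n}\<close>. This
  matters only for \<open>n = 0\<close>, where it is \<open>1\<close> and the index set is empty, as it has to be for
  a family of \<open>2 ^ (2 * n) - 2 ^ n\<close> members.\<close>

definition index3 :: "nat \<Rightarrow> (nat \<times> nat) set" where
  "index3 n = {(p, q). p \<in> laver_set n \<and> q \<in> laver_set n \<and> p \<noteq> pmod (2 ^ n - 1) (2 ^ n)}"

end

theory Submission
  imports Defs "HOL-Computational_Algebra.Primes"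
begin

text \<open>Write \<open>N = 2 ^ n\<close>. Each row \<open>y \<mapsto> x \<triangleright> y\<close> with \<open>x < N\<close> is periodic and increases from
  \<open>x + 1\<close> to \<open>N\<close> over a period, so \<open>x \<triangleright> y > x\<close>. Setting the last variable to \<open>1\<close> in a cocycle
  identity and descending along the first variables therefore shows that a 2-cocycle is
  determined by the values \<open>\<phi> (x, 1)\<close> and a 3-cocycle by the values \<open>\<phi> (x, y, 1)\<close>.

  In degree 2, a coboundary and a constant realise all values \<open>\<phi> (x, 1)\<close>. The function \<open>\<psi>\<^sub>q\<close>
  is minus the coboundary of the indicator of \<open>{y. \<exists>p. q = p \<triangleright> y}\<close>, and these indicators are
  unitriangular because \<open>\<exists>p. q = p \<triangleright> y\<close> is a partial order in \<open>y\<close> and \<open>q\<close>. Transitivity comes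
  from the composition of left translations. Antisymmetry is proved by induction on \<open>n\<close>: two
  elements each reachable from the other are congruent modulo \<open>N / 2\<close>, and if they differ, the
  smaller one is a fixed point \<open>\<le> N / 2\<close> of a left translation other than the identity, which
  does not exist.

  In degree 3, the slices \<open>\<phi> (N, _, _)\<close> and \<open>\<phi> (_, N, _)\<close> of a 3-cocycle are 2-cocycles, which
  forces \<open>\<phi> (N, x, 1) + \<phi> (x, N, 1) = 2 \<phi> (N, N, 1)\<close>. After subtracting a constant this is
  exactly the condition for solving \<open>\<phi> (x, y, 1) = d\<theta> (x, y, 1)\<close> recursively. The
  ambiguity in \<open>\<theta>\<close> is a 2-cocycle, and a 2-cocycle is determined, with arbitrary values, by
  its row \<open>N - 1\<close>, hence the exclusion of that row.\<close>

section \<open>Rows of a Laver table\<close>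

locale laver =
  fixes n :: nat and lop :: "nat \<Rightarrow> nat \<Rightarrow> nat" (infixl "\<triangleright>" 70)
  assumes table: "laver_table n lop"
begin

abbreviation A :: "nat set" where "A \<equiv> laver_set n"
abbreviation N :: nat where "N \<equiv> 2 ^ n"

lemma mem_A: "x \<in> A \<longleftrightarrow> 1 \<le> x \<and> x \<le> N"
  by (auto simp: laver_set_def)

lemma finite_A: "finite A"
  by (simp add: laver_set_def)

lemma one_in [simp]: "1 \<in> A" "Suc 0 \<in> A" and top_in [simp]: "N \<in> A"
  by (auto simp: mem_A)

lemma closed [simp, intro]: "x \<in> A \<Longrightarrow> y \<in> A \<Longrightarrow> x \<triangleright> y \<in> A"
  using table by (simp add: laver_table_def)

lemma right_one: "x \<in> A \<Longrightarrow> x < N \<Longrightarrow> x \<triangleright> 1 = Suc x"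
  using table by (cases "Suc x = N") (auto simp: laver_table_def pmod_def mem_A)

lemma top_one: "N \<triangleright> 1 = 1"
proof -
  have "N \<triangleright> 1 = pmod (N + 1) N" using table top_in unfolding laver_table_def by blast
  moreover have "pmod (N + 1) N = 1"
  proof (cases n)
    case (Suc k)
    have "1 < N" by (rule one_less_power) (simp_all add: Suc)
    then have "(N + 1) mod N = 1" by (simp only: mod_add_self1 mod_less)
    then show ?thesis by (simp add: pmod_def)
  qed (simp add: pmod_def)
  ultimately show ?thesis by simp
qed

lemma distrib_one: "x \<in> A \<Longrightarrow> y \<in> A \<Longrightarrow> x \<triangleright> (y \<triangleright> 1) = (x \<triangleright> y) \<triangleright> (x \<triangleright> 1)"
  using table unfolding laver_table_def by blast

lemma A_induct [consumes 1, case_names one step]: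
  assumes "y \<in> A" and "P 1"
    and "\<And>y. y \<in> A \<Longrightarrow> y < N \<Longrightarrow> Suc y \<in> A \<Longrightarrow> P y \<Longrightarrow> P (Suc y)"
  shows "P y"
proof -
  have "1 \<le> y" "y \<le> N" using assms(1) by (auto simp: mem_A)
  then show ?thesis
  proof (induction y rule: dec_induct)
    case base
    show ?case by (rule assms(2))
  next
    case (step y)
    then show ?case using assms(3)[of y] by (auto simp: mem_A)
  qed
qed

text \<open>Entries of a row \<open>x < N\<close> lie above \<open>x\<close>, so recursions in the
  first variable run upwards and end at the identity row \<open>N\<close>.\<close>

lemma A_descend [consumes 1, case_names above]:
  assumes "x \<in> A"
    and "\<And>x. x \<in> A \<Longrightarrow> (\<And>u. u \<in> A \<Longrightarrow> x < u \<Longrightarrow> P u) \<Longrightarrow> P x"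
  shows "P x"
  using assms(1)
proof (induction "N - x" arbitrary: x rule: less_induct)
  case less
  show ?case
  proof (rule assms(2)[OF less.prems])
    fix u assume "u \<in> A" "x < u"
    then show "P u" using less.prems by (intro less.hyps) (auto simp: mem_A)
  qed
qed

lemma right_Suc:
  assumes "x \<in> A" "y \<in> A" "y < N"
  shows "x \<triangleright> Suc y = (x \<triangleright> y) \<triangleright> (x \<triangleright> 1)"
  using distrib_one[OF assms(1,2)] right_one[OF assms(2,3)] by simp

lemma top_left [simp]: "y \<in> A \<Longrightarrow> N \<triangleright> y = y"
proof (induction y rule: A_induct)
  case one
  show ?case by (rule top_one)
next
  case (step y)
  then show ?case using right_Suc[of N y] top_one right_one[of y] by simp
qed

text \<open>Induction downwards in \<open>x\<close> and upwards in \<open>y\<close>: the next entry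
  \<open>(x \<triangleright> y) \<triangleright> Suc x\<close> lies in a later row and so exceeds
  \<open>x \<triangleright> y\<close>, unless \<open>x \<triangleright> y = N\<close>, where the
  identity row resets it to \<open>Suc x\<close>.\<close>

lemma gt_left:
  assumes "x \<in> A" "x < N" "y \<in> A"
  shows "x < x \<triangleright> y"
  using assms
proof (induction x arbitrary: y rule: A_descend)
  case (above x)
  show ?case using \<open>y \<in> A\<close>
  proof (induction y rule: A_induct)
    case one
    then show ?case using above.hyps above.prems right_one by simp
  next
    case (step y)
    have eq: "x \<triangleright> Suc y = (x \<triangleright> y) \<triangleright> Suc x"
      using right_Suc[of x y] right_one[of x] above step by simp
    have S: "Suc x \<in> A" using above by (auto simp: mem_A)
    show ?case
    proof (cases "x \<triangleright> y = N")
      case True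
      then show ?thesis using eq S by simp
    next
      case False
      moreover have "x \<triangleright> y \<in> A" using above step by auto
      ultimately have "x \<triangleright> y < N" by (auto simp: mem_A)
      then have "x \<triangleright> y < (x \<triangleright> y) \<triangleright> Suc x"
        using above.IH[of "x \<triangleright> y" "Suc x"] step S \<open>x \<triangleright> y \<in> A\<close> by auto
      then show ?thesis using eq step by simp
    qed
  qed
qed

text \<open>Applying row \<open>x\<close> to \<open>N \<triangleright> 1 = 1\<close> makes
  \<open>Suc x\<close> a fixed point of row \<open>x \<triangleright> N\<close>. If that index were
  below \<open>N\<close>, \<open>gt_left\<close> would place it strictly between \<open>x\<close>
  and \<open>Suc x\<close>.\<close>

lemma right_top [simp]:
  assumes "x \<in> A"
  shows "x \<triangleright> N = N"
proof (rule ccontr)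
  assume ne: "x \<triangleright> N \<noteq> N"
  then have "x \<noteq> N" by auto
  then have x: "x < N" using assms by (auto simp: mem_A)
  have u: "x \<triangleright> N \<in> A" "x \<triangleright> N < N" using assms ne closed[of x N] by (auto simp: mem_A)
  have S: "Suc x \<in> A" using x assms by (auto simp: mem_A)
  have "Suc x = (x \<triangleright> N) \<triangleright> Suc x"
    using distrib_one[of x N] right_one[of x] assms x top_one by simp
  moreover have "x \<triangleright> N < (x \<triangleright> N) \<triangleright> Suc x" by (rule gt_left[OF u S])
  ultimately show False using gt_left[OF assms x top_in] by simp
qed

text \<open>Laver's induction: downwards in \<open>x\<close>, then downwards in \<open>y\<close>,
  then upwards in \<open>z\<close> from the defining law at \<open>1\<close>. The regroupings use
  the law with \<open>y\<close> replaced by \<open>y \<triangleright> z\<close> and with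
  \<open>x\<close> replaced by \<open>x \<triangleright> y\<close>, both larger.\<close>

lemma ld:
  assumes "x \<in> A" "y \<in> A" "z \<in> A"
  shows "x \<triangleright> (y \<triangleright> z) = (x \<triangleright> y) \<triangleright> (x \<triangleright> z)"
  using assms
proof (induction x arbitrary: y z rule: A_descend)
  case (above x)
  note IHx = above.IH and x = above.hyps
  show ?case
  proof (cases "x = N")
    case True
    then show ?thesis using above.prems by simp
  next
    case False
    then have xN: "x < N" using x by (auto simp: mem_A)
    show ?thesis using \<open>y \<in> A\<close> \<open>z \<in> A\<close>
    proof (induction y arbitrary: z rule: A_descend)
      case (above y)
      note IHy = above.IH and y = above.hyps
      show ?case
      proof (cases "y = N")
        case True
        then show ?thesis using above.prems x by simp
      next
        case False
        then have yN: "y < N" using y by (auto simp: mem_A)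
        show ?thesis using \<open>z \<in> A\<close>
        proof (induction z rule: A_induct)
          case one
          show ?case by (rule distrib_one[OF x y])
        next
          case (step z)
          have "x \<triangleright> (y \<triangleright> Suc z) = x \<triangleright> ((y \<triangleright> z) \<triangleright> (y \<triangleright> 1))"
            using right_Suc[of y z] y step by simp
          also have "\<dots> = (x \<triangleright> (y \<triangleright> z)) \<triangleright> (x \<triangleright> (y \<triangleright> 1))"
            using IHy[of "y \<triangleright> z" "y \<triangleright> 1"] gt_left[OF y yN] y step by auto
          also have "\<dots> = ((x \<triangleright> y) \<triangleright> (x \<triangleright> z)) \<triangleright> ((x \<triangleright> y) \<triangleright> (x \<triangleright> 1))"
            using step.IH distrib_one[OF x y] by simp
          also have "\<dots> = (x \<triangleright> y) \<triangleright> ((x \<triangleright> z) \<triangleright> (x \<triangleright> 1))"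
            using IHx[of "x \<triangleright> y" "x \<triangleright> z" "x \<triangleright> 1"] gt_left[OF x xN y] x y step by auto
          also have "\<dots> = (x \<triangleright> y) \<triangleright> (x \<triangleright> Suc z)"
            using right_Suc[of x z] x step by simp
          finally show ?case .
        qed
      qed
    qed
  qed
qed

lemma ex_succ:
  assumes "u \<in> A"
  obtains w where "w \<in> A" "w \<triangleright> 1 = u"
proof (cases "u = 1")
  case True
  then show ?thesis using that[of N] top_one by simp
next
  case False
  then have "u - 1 \<in> A" "u - 1 < N" using assms by (auto simp: mem_A)
  then show ?thesis using that[of "u - 1"] right_one[of "u - 1"] False assms by (auto simp: mem_A)
qed

text \<open>The witness \<open>w\<close> is Laver's composite \<open>x \<circ> y\<close>, determined by \<open>w + 1 = x \<triangleright> (y + 1)\<close>.\<close>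

lemma ex_comp:
  assumes "x \<in> A" "y \<in> A"
  obtains w where "w \<in> A" "\<And>z. z \<in> A \<Longrightarrow> w \<triangleright> z = x \<triangleright> (y \<triangleright> z)"
proof -
  obtain w where w: "w \<in> A" "w \<triangleright> 1 = x \<triangleright> (y \<triangleright> 1)"
    using ex_succ[of "x \<triangleright> (y \<triangleright> 1)"] assms by auto
  have "w \<triangleright> z = x \<triangleright> (y \<triangleright> z)" if "z \<in> A" for z
    using that
  proof (induction z rule: A_induct)
    case one
    show ?case by (rule w(2))
  next
    case (step z)
    have "w \<triangleright> Suc z = (x \<triangleright> (y \<triangleright> z)) \<triangleright> (x \<triangleright> (y \<triangleright> 1))"
      using right_Suc[of w z] step w by simp
    also have "\<dots> = x \<triangleright> (y \<triangleright> Suc z)"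
      using ld[of x "y \<triangleright> z" "y \<triangleright> 1"] right_Suc[of y z] assms step by auto
    finally show ?case .
  qed
  with w(1) show ?thesis by (rule that)
qed

lemma row_period:
  assumes x: "x \<in> A"
  obtains k where "k \<le> n"
    "\<And>y z. y \<in> A \<Longrightarrow> z \<in> A \<Longrightarrow> x \<triangleright> y = x \<triangleright> z \<longleftrightarrow> y mod 2 ^ k = z mod 2 ^ k"
    "x < N \<Longrightarrow> x + 2 ^ k \<le> N"
proof (cases "x = N")
  case True
  have "y = z \<longleftrightarrow> y mod N = z mod N" if "y \<in> A" "z \<in> A" for y z
    using that by (cases "y = N"; cases "z = N") (auto simp: mem_A)
  then show ?thesis using that[of n] True by simp
next
  case False
  then have xN: "x < N" using x by (auto simp: mem_A)
  have Sx: "Suc x \<in> A" using x xN by (auto simp: mem_A)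
  \<comment> \<open>The period is the first column with entry \<open>N\<close>: the entry after it
    is \<open>N \<triangleright> Suc x = Suc x\<close>, with which the row started.\<close>
  define d where "d = (LEAST y. y \<in> A \<and> x \<triangleright> y = N)"
  have d: "d \<in> A" "x \<triangleright> d = N"
    using LeastI[of "\<lambda>y. y \<in> A \<and> x \<triangleright> y = N" N] x by (auto simp: d_def)
  have least: "x \<triangleright> y \<noteq> N" if "y \<in> A" "y < d" for y
    using not_less_Least[of y "\<lambda>y. y \<in> A \<and> x \<triangleright> y = N"] that by (auto simp: d_def)
  have Suc_eq: "x \<triangleright> Suc y = (x \<triangleright> y) \<triangleright> Suc x" if "y \<in> A" "y < N" for y
    using right_Suc[of x y] right_one[of x] x xN that by simp
  have incr: "x \<triangleright> y < x \<triangleright> Suc y" if "1 \<le> y" "y < d" for y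
  proof -
    have y: "y \<in> A" "y < N" using that d by (auto simp: mem_A)
    have "x \<triangleright> y \<in> A" using x y by auto
    moreover have "x \<triangleright> y < N" using least[OF y(1) that(2)] \<open>x \<triangleright> y \<in> A\<close> by (auto simp: mem_A)
    ultimately show ?thesis using Suc_eq[OF y] gt_left[of "x \<triangleright> y" "Suc x"] Sx by simp
  qed
  have mono: "x \<triangleright> y < x \<triangleright> z" if "1 \<le> y" "y < z" "z \<le> d" for y z
    using that(2,1,3)
  proof (induction rule: strict_inc_induct)
    case (base i)
    then show ?case using incr[of i] by simp
  next
    case (step i)
    then show ?case using incr[of i] by simp
  qed
  have per: "x \<triangleright> (y + d) = x \<triangleright> y" if "1 \<le> y" "y + d \<le> N" for y
    using that
  proof (induction y rule: dec_induct)
    case base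
    then show ?case using Suc_eq[of d] d x xN right_one[of x] Sx by simp
  next
    case (step y)
    then show ?case using Suc_eq[of "y + d"] Suc_eq[of y] by (auto simp: mem_A)
  qed
  have d0: "0 < d" using d by (auto simp: mem_A)
  have per_mult: "x \<triangleright> (y + j * d) = x \<triangleright> y" if "1 \<le> y" "y + j * d \<le> N" for y j
    using that
  proof (induction j)
    case (Suc j)
    then show ?case using per[of "y + j * d"] by (simp add: algebra_simps)
  qed simp
  have red: "x \<triangleright> y = x \<triangleright> pmod y d" "pmod y d \<in> {1..d}" "pmod y d mod d = y mod d" if "y \<in> A" for y
  proof -
    show p: "pmod y d \<in> {1..d}" "pmod y d mod d = y mod d"
      using pmod_unique[OF d0, of "pmod y d" y] by auto
    show "x \<triangleright> y = x \<triangleright> pmod y d"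
    proof (cases "y mod d = 0")
      case True
      then obtain j where j: "y = d * j" by auto
      then have "j \<noteq> 0" using that by (auto simp: mem_A)
      then obtain i where "j = Suc i" by (cases j) auto
      then have "y = d + i * d" using j by simp
      then show ?thesis using per_mult[of d i] that d0 True by (simp add: mem_A pmod_def)
    next
      case False
      have "y = y mod d + (y div d) * d" by simp
      then show ?thesis using per_mult[of "y mod d" "y div d"] that False by (simp add: mem_A pmod_def)
    qed
  qed
  have iff: "x \<triangleright> y = x \<triangleright> z \<longleftrightarrow> y mod d = z mod d" if "y \<in> A" "z \<in> A" for y z
  proof
    assume "x \<triangleright> y = x \<triangleright> z"
    then have "x \<triangleright> pmod y d = x \<triangleright> pmod z d" using red that by metis
    then have "pmod y d = pmod z d"
      using mono[of "pmod y d" "pmod z d"] mono[of "pmod z d" "pmod y d"] red(2)[OF that(1)] red(2)[OF that(2)]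
      by (cases "pmod y d" "pmod z d" rule: linorder_cases) auto
    then show "y mod d = z mod d" using red(3) that by metis
  next
    assume "y mod d = z mod d"
    then show "x \<triangleright> y = x \<triangleright> z" using red(1) that by (metis pmod_def)
  qed
  \<comment> \<open>Column \<open>N\<close> has the same entry \<open>N\<close> as column
    \<open>d\<close>, so \<open>d\<close> divides a power of two.\<close>
  have "N mod d = 0" using iff[of d N] d x by simp
  then have "d dvd N" by auto
  then obtain k where k: "k \<le> n" "d = 2 ^ k" by (auto simp: divides_primepow_nat)
  have "inj_on (lop x) {1..d}"
    by (rule linorder_inj_onI) (use mono in fastforce)+
  moreover have "lop x ` {1..d} \<subseteq> {x<..N}"
    using gt_left[OF x xN] closed[OF x] d by (auto simp: mem_A)
  ultimately have "d \<le> N - x"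
    using card_inj_on_le[of "lop x" "{1..d}" "{x<..N}"] by simp
  then show ?thesis using that[OF k(1)] iff k xN by auto
qed

end

section \<open>Projection to the next smaller table\<close>

lemma pmod_in: "0 < m \<Longrightarrow> pmod a m \<in> {1..m}" and pmod_mod: "0 < m \<Longrightarrow> pmod a m mod m = a mod m"
  using pmod_unique[of m "pmod a m" a] by auto

lemma pmod_eq_iff: "0 < m \<Longrightarrow> pmod a m = pmod b m \<longleftrightarrow> a mod m = b mod m"
  by (metis pmod_def pmod_mod)

lemma pmod_self: "1 \<le> a \<Longrightarrow> a \<le> m \<Longrightarrow> pmod a m = a"
  by (cases "a = m") (auto simp: pmod_def)

lemma mod_eq_close:
  fixes a b m :: nat
  assumes "a mod m = b mod m" "a < b + m" "b < a + m"
  shows "a = b"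
proof -
  have "a = b" if "a mod m = b mod m" "a \<le> b" "b < a + m" for a b :: nat
  proof -
    have "m dvd b - a" using that by (simp add: mod_eq_dvd_iff_nat[of a b, symmetric])
    moreover have "b - a < m" using that by linarith
    ultimately have "b - a = 0" using nat_dvd_not_less by blast
    then show ?thesis using that by simp
  qed
  from this[of a b] this[of b a] assms show ?thesis by (cases "a \<le> b") auto
qed

lemma pow2_mod: "k \<le> n \<Longrightarrow> (2::nat) ^ n mod 2 ^ k = 0"
  by (simp add: dvd_imp_mod_0 le_imp_power_dvd)

section \<open>Divisibility of row periods\<close>

context laver
begin

text \<open>The entry \<open>N\<close> stands in column \<open>N\<close>, hence exactly in the
  columns divisible by the period. So \<open>x \<triangleright> 2 ^ j = N\<close> expresses that the
  period divides \<open>2 ^ j\<close>.\<close>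

lemma row_eq:
  assumes "x \<in> A" "j \<le> n" "x \<triangleright> 2 ^ j = N" "y \<in> A" "z \<in> A" "y mod 2 ^ j = z mod 2 ^ j"
  shows "x \<triangleright> y = x \<triangleright> z"
proof -
  obtain k where k: "k \<le> n"
    "\<And>y z. y \<in> A \<Longrightarrow> z \<in> A \<Longrightarrow> x \<triangleright> y = x \<triangleright> z \<longleftrightarrow> y mod 2 ^ k = z mod 2 ^ k"
    using row_period[OF assms(1)] by metis
  have "(2::nat) ^ j \<in> A" using assms(2) by (auto simp: mem_A)
  then have "2 ^ j mod 2 ^ k = N mod 2 ^ k" using k(2)[of "2 ^ j" N] assms(1,3) by simp
  then have "(2::nat) ^ k dvd 2 ^ j" using pow2_mod[OF k(1)] by (simp only: dvd_eq_mod_eq_0)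
  then have "w mod 2 ^ j mod 2 ^ k = w mod 2 ^ k" for w :: nat by (rule mod_mod_cancel)
  from this[of y] this[of z] have "y mod 2 ^ k = z mod 2 ^ k" using assms(6) by simp
  then show ?thesis using k(2) assms by blast
qed

text \<open>A period of length \<open>2 ^ k\<close> consists of \<open>2 ^ k\<close> distinct
  entries above \<open>x\<close>, so a row with fewer than \<open>2 ^ j\<close> elements above it
  has a shorter period.\<close>

lemma row_top_below:
  assumes "x \<in> A" "j \<le> n" "x + 2 ^ j > N" "x < N"
  shows "\<exists>i<j. x \<triangleright> 2 ^ i = N"
proof -
  obtain k where k: "k \<le> n"
    "\<And>y z. y \<in> A \<Longrightarrow> z \<in> A \<Longrightarrow> x \<triangleright> y = x \<triangleright> z \<longleftrightarrow> y mod 2 ^ k = z mod 2 ^ k"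
    "x + 2 ^ k \<le> N"
    using row_period[OF assms(1)] assms(4) by metis
  have "(2::nat) ^ k < 2 ^ j" using k(3) assms by linarith
  then have "k < j" by simp
  moreover have "(2::nat) ^ k \<in> A" using k(1) by (auto simp: mem_A)
  then have "x \<triangleright> 2 ^ k = N"
    using k(2)[of "2 ^ k" N] pow2_mod[OF k(1)] assms(1) by simp
  ultimately show ?thesis by blast
qed

lemma row_top_mono:
  assumes "x \<in> A" "i \<le> j" "j \<le> n" "x \<triangleright> 2 ^ i = N"
  shows "x \<triangleright> 2 ^ j = N"
proof -
  have "(2::nat) ^ j \<in> A" using assms(3) by (auto simp: mem_A)
  then show ?thesis
    using row_eq[of x i "2 ^ j" N] assms pow2_mod[of i j] pow2_mod[of i n] by simp
qed

text \<open>The period divides the difference of two columns with equal entries, and here this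
  difference is again \<open>2 ^ i\<close>.\<close>

lemma row_top_repeat:
  assumes "x \<in> A" "i < n" "x \<triangleright> 2 ^ Suc i = x \<triangleright> 2 ^ i"
  shows "x \<triangleright> 2 ^ i = N"
proof -
  obtain k where k: "k \<le> n"
    "\<And>y z. y \<in> A \<Longrightarrow> z \<in> A \<Longrightarrow> x \<triangleright> y = x \<triangleright> z \<longleftrightarrow> y mod 2 ^ k = z mod 2 ^ k"
    using row_period[OF assms(1)] by metis
  have pA: "(2::nat) ^ i \<in> A" "(2::nat) ^ Suc i \<in> A"
    using assms(2) power_increasing[of "Suc i" n "2::nat"] by (auto simp: mem_A)
  then have "2 ^ Suc i mod 2 ^ k = (2::nat) ^ i mod 2 ^ k" using k(2) assms(3) by blast
  then have "(2::nat) ^ k dvd 2 ^ Suc i - 2 ^ i"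
    by (simp only: mod_eq_dvd_iff_nat power_increasing le_SucI order_refl one_le_numeral)
  then have "(2::nat) ^ i mod 2 ^ k = N mod 2 ^ k"
    using pow2_mod[OF k(1)] by (simp add: dvd_imp_mod_0)
  then show ?thesis using k(2)[of "2 ^ i" N] pA assms(1) by simp
qed

text \<open>Only the identity row has full period; all others repeat after half the table. This
  makes reduction modulo \<open>2 ^ m\<close> possible.\<close>

lemma row_top_half:
  assumes "x \<in> A" "x < N" "n = Suc m"
  shows "x \<triangleright> 2 ^ m = N"
proof -
  have "x + 2 ^ n > N" using assms(1) by (auto simp: mem_A)
  from row_top_below[OF assms(1) _ this assms(2)] obtain i where "i < n" "x \<triangleright> 2 ^ i = N" by auto
  then show ?thesis using row_top_mono[of x i m] assms by simp
qed

end

locale laver_suc = laver "Suc m" lop for m :: nat and lop (infixl "\<triangleright>" 70)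
begin

abbreviation M :: nat where "M \<equiv> 2 ^ m"

declare power_Suc [simp del]

lemma N_eq: "N = M + M"
  by (simp add: power_Suc)

lemma mem_A': "x \<in> A \<longleftrightarrow> 1 \<le> x \<and> x \<le> M + M"
  by (simp add: mem_A N_eq)

lemma M_pos: "0 < M" by simp

lemma M_in: "M \<in> A"
  by (auto simp: mem_A')

lemma cong_right:
  assumes "x \<in> A" "y \<in> A" "z \<in> A" "y mod M = z mod M"
  shows "(x \<triangleright> y) mod M = (x \<triangleright> z) mod M"
proof (cases "x = N")
  case False
  then have "x < N" using assms(1) by (auto simp: mem_A)
  from row_top_half[OF assms(1) this refl] show ?thesis
    using row_eq[of x m y z] assms by simp
qed (use assms in simp)

text \<open>Row \<open>M + y\<close> with \<open>y < M\<close> has equal entries in columns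
  \<open>M + 1\<close> and \<open>1\<close>, so each step of the recursion along row
  \<open>M\<close> just adds one.\<close>

lemma M_left:
  assumes "1 \<le> y" "y \<le> M"
  shows "M \<triangleright> y = M + y"
  using assms
proof (induction y rule: dec_induct)
  case base
  show ?case using right_one[OF M_in] by simp
next
  case (step y)
  have u: "M + y \<in> A" "M + y < N" "y \<in> A" "y < N" "Suc M \<in> A" "M < N"
    using step by (auto simp: mem_A' N_eq)
  have "(M + y) \<triangleright> Suc M = (M + y) \<triangleright> 1"
    by (rule row_eq[OF u(1) _ row_top_half[OF u(1,2) refl]]) (use u in \<open>auto simp: mod_Suc\<close>)
  then show ?case
    using right_Suc[of M y] right_one[of M] right_one[of "M + y"] u step M_in by simp
qed

text \<open>Downward induction on the lower half, and along the columns within each row, carries the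
  congruence through \<open>x \<triangleright> Suc y = (x \<triangleright> y) \<triangleright> Suc
  x\<close>. The start compares row \<open>M\<close> with the identity row \<open>N\<close>.\<close>

lemma cong_left:
  assumes "x \<in> {1..M}" "y \<in> A"
  shows "((x + M) \<triangleright> y) mod M = (x \<triangleright> y) mod M"
proof -
  have "\<And>y. y \<in> A \<Longrightarrow> ((x + M) \<triangleright> y) mod M = (x \<triangleright> y) mod M" if "x \<in> A" "x \<le> M" for x
    using that
  proof (induction x rule: A_descend)
    case (above x)
    show ?case
    proof (cases "x = M")
      case True
      have "(M \<triangleright> y) mod M = y mod M"
      proof -
        have p: "pmod y M \<in> {1..M}" "pmod y M mod M = y mod M"
          by (rule pmod_in[OF M_pos], rule pmod_mod[OF M_pos])
        then have "pmod y M \<in> A" by (auto simp: mem_A')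
        then have "(M \<triangleright> y) mod M = (M \<triangleright> pmod y M) mod M"
          using cong_right[OF M_in, of y "pmod y M"] above.prems p by simp
        also have "\<dots> = y mod M" using M_left p by simp
        finally show ?thesis .
      qed
      then show ?thesis using True above.prems top_left[of y] by (simp add: N_eq)
    next
      case False
      then have xM: "x < M" using above by simp
      have x: "x \<in> A" "x < N" "x + M \<in> A" "x + M < N" "Suc x \<in> A" "Suc (x + M) \<in> A"
        using above.hyps xM by (auto simp: mem_A' N_eq)
      show ?thesis using \<open>y \<in> A\<close>
      proof (induction y rule: A_induct)
        case one
        then show ?case using right_one x by (simp add: mod_Suc)
      next
        case (step y)
        define a b where "a = (x + M) \<triangleright> y" and "b = x \<triangleright> y"
        have ab: "a \<in> A" "b \<in> A" "x + M < a" "x < b" "a mod M = b mod M"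
          using x step gt_left unfolding a_def b_def by auto
        \<comment> \<open>Entries of row \<open>x + M\<close> exceed \<open>x + M\<close>, so after
          subtracting \<open>M\<close> they still exceed \<open>x\<close> and the induction
          hypothesis applies.\<close>
        have shift: "(c \<triangleright> Suc x) mod M = ((c - M) \<triangleright> Suc x) mod M" if "c \<in> A" "M < c" "x < c - M" for c
          using above.IH[of "c - M" "Suc x"] that x by (auto simp: mem_A')
        have "(a \<triangleright> Suc (x + M)) mod M = (a \<triangleright> Suc x) mod M"
          by (rule cong_right) (use ab x in \<open>auto simp: mod_Suc\<close>)
        also have "\<dots> = ((a - M) \<triangleright> Suc x) mod M" using shift[of a] ab by auto
        \<comment> \<open>Being congruent to \<open>a\<close>, which lies in the upper half,
          \<open>b\<close> is \<open>a - M\<close> or \<open>a\<close> according to its own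
          half.\<close>
        also have "\<dots> = (b \<triangleright> Suc x) mod M"
        proof (cases "b \<le> M")
          case True
          have m: "(a - M) mod M = b mod M" using ab by (simp add: le_mod_geq[of M a])
          have "a - M \<le> M" "1 \<le> b" "1 \<le> a - M" using ab by (auto simp: mem_A')
          then have "a - M = b" using True by (intro mod_eq_close[OF m]) linarith+
          then show ?thesis by simp
        next
          case False
          moreover have "a \<le> M + M" "b \<le> M + M" using ab by (auto simp: mem_A')
          ultimately have "a = b" using ab(3,4) by (intro mod_eq_close[OF ab(5)]) linarith+
          then show ?thesis using shift[of b] ab by simp
        qed
        finally show ?case
          using right_Suc[of x y] right_Suc[of "x + M" y] right_one[of x] right_one[of "x + M"] x step
          by (simp add: a_def b_def)
      qed
    qed
  qed
  then show ?thesis using assms by (auto simp: mem_A')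
qed

lemma cong_M:
  assumes "x \<in> A" "x' \<in> A" "y \<in> A" "y' \<in> A" "x mod M = x' mod M" "y mod M = y' mod M"
  shows "(x \<triangleright> y) mod M = (x' \<triangleright> y') mod M"
proof -
  have red: "(x \<triangleright> y) mod M = (pmod x M \<triangleright> y) mod M" if "x \<in> A" for x
  proof (cases "x \<le> M")
    case True
    then show ?thesis using that by (simp add: pmod_self mem_A')
  next
    case False
    then have "x - M \<in> {1..M}" using that by (auto simp: mem_A')
    moreover from this have "pmod x M = x - M"
      using False pmod_eq_iff[OF M_pos, of x "x - M"] by (simp add: pmod_self le_mod_geq)
    ultimately show ?thesis using cong_left[of "x - M" y] assms(3) False by simp
  qed
  have "pmod x M = pmod x' M" using assms(5) by (simp add: pmod_eq_iff)
  then have "(x \<triangleright> y) mod M = (x' \<triangleright> y) mod M" using red assms(1,2) by metis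
  also have "\<dots> = (x' \<triangleright> y') mod M" by (rule cong_right) (use assms in auto)
  finally show ?thesis .
qed

lemma pmod_A: "pmod x M \<in> laver_set m" "pmod x M \<in> A"
  using pmod_in[OF M_pos, of x] unfolding mem_A' by (auto simp: laver_set_def)

lemma pmod_cong: "x \<in> A \<Longrightarrow> y \<in> A \<Longrightarrow> pmod (pmod x M \<triangleright> pmod y M) M = pmod (x \<triangleright> y) M"
  using cong_M[of "pmod x M" x "pmod y M" y] pmod_A by (simp add: pmod_eq_iff pmod_mod)

lemma pmod_eq_top: "x \<in> A \<Longrightarrow> pmod x M = M \<Longrightarrow> x = M \<or> x = N"
proof -
  assume x: "x \<in> A" and "pmod x M = M"
  then have "x mod M = 0"
    using mod_less_divisor[OF M_pos, of x] unfolding pmod_def by (metis less_irrefl)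
  then have "M dvd x" by auto
  then obtain j where "x = M * j" by auto
  moreover from this have "1 \<le> M * j" "M * j \<le> M * 2" using x unfolding mem_A' by linarith+
  then have "1 \<le> j" "j \<le> 2" by (simp, simp only: mult_le_cancel1 M_pos)
  then have "j = 1 \<or> j = 2" by linarith
  ultimately show ?thesis by (auto simp: N_eq)
qed

text \<open>By \<open>pmod_cong\<close>, reduction modulo \<open>M\<close> is a homomorphism; this
  allows proofs by induction on the exponent.\<close>

lemma quotient: "laver m (\<lambda>x y. pmod (x \<triangleright> y) M)"
proof
  have in_A: "x \<in> A" if "x \<in> laver_set m" for x
    using that unfolding mem_A' by (auto simp: laver_set_def)
  have id: "pmod x M = x" if "x \<in> laver_set m" for x
    using that by (simp add: laver_set_def pmod_self)
  have "pmod (x \<triangleright> pmod (y \<triangleright> 1) M) M = pmod (pmod (x \<triangleright> y) M \<triangleright> pmod (x \<triangleright> 1) M) M"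
    if "x \<in> laver_set m" "y \<in> laver_set m" for x y
  proof -
    have xy: "x \<in> A" "y \<in> A" "y \<triangleright> 1 \<in> A" "x \<triangleright> y \<in> A" "x \<triangleright> 1 \<in> A"
      using in_A[OF that(1)] in_A[OF that(2)] by auto
    have "pmod (x \<triangleright> pmod (y \<triangleright> 1) M) M = pmod (x \<triangleright> (y \<triangleright> 1)) M"
      using pmod_cong[OF xy(1,3)] by (simp only: id[OF that(1)])
    also have "\<dots> = pmod ((x \<triangleright> y) \<triangleright> (x \<triangleright> 1)) M"
      by (simp only: distrib_one[OF xy(1,2)])
    also have "\<dots> = pmod (pmod (x \<triangleright> y) M \<triangleright> pmod (x \<triangleright> 1) M) M"
      by (simp only: pmod_cong[OF xy(4,5)])
    finally show ?thesis .
  qed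
  moreover have "pmod (x \<triangleright> 1) M = pmod (x + 1) M" if "x \<in> laver_set m" for x
  proof -
    have "x \<triangleright> 1 = x + 1"
      using right_one[OF in_A[OF that]] that by (auto simp: laver_set_def N_eq)
    then show ?thesis by (simp only:)
  qed
  ultimately show "laver_table m (\<lambda>x y. pmod (x \<triangleright> y) M)"
    unfolding laver_table_def using pmod_A(1) by blast
qed

end

lemma laver_suc_intro: "laver (Suc m) lop \<Longrightarrow> laver_suc m lop"
  by (simp add: laver_suc_def)

text \<open>The condition \<open>e \<triangleright> 2 ^ k = 2 ^ n\<close> says that the period of row \<open>e\<close> divides \<open>2 ^ k\<close>.
  In passing from \<open>m\<close> to \<open>m + 1\<close> the row of \<open>2 ^ m - 2 ^ k\<close> doubles its period, because the
  rows between \<open>2 ^ m - 2 ^ k\<close> and \<open>2 ^ m\<close> have period at most \<open>2 ^ k\<close> and so the row starts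
  with consecutive integers.\<close>

lemma period_of_multiple:
  assumes "laver n lop" "e \<in> laver_set n" "e < 2 ^ n" "2 ^ k dvd e" "lop e (2 ^ k) = 2 ^ n"
  shows "e = 2 ^ n - 2 ^ k"
  using assms
proof (induction n arbitrary: e lop)
  case 0
  then show ?case by (auto simp: laver_set_def)
next
  case (Suc m)
  note power_Suc [simp del]
  interpret laver_suc m lop by (rule laver_suc_intro[OF Suc.prems(1)])
  interpret Q: laver m "\<lambda>x y. pmod (lop x y) M" by (rule quotient)
  have e0: "0 < e" using Suc.prems(2) by (auto simp: mem_A')
  have "2 ^ k \<le> e" using Suc.prems(4) e0 by (simp add: dvd_imp_le)
  then have "(2::nat) ^ k < 2 ^ Suc m" using Suc.prems(3) by (rule le_less_trans)
  then have k: "k < Suc m" by (simp only: power_strict_increasing_iff one_less_numeral_iff semiring_norm)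
  have kM: "1 \<le> (2::nat) ^ k" "2 ^ k \<le> M" using k by simp_all
  then have kA: "2 ^ k \<in> A" unfolding mem_A' by linarith
  show ?case
  proof (cases e M rule: linorder_cases)
    case equal
    then have "M + 2 ^ k = N" using Suc.prems(5) M_left[OF kM] by simp
    then show ?thesis using equal by linarith
  next
    case greater
    \<comment> \<open>Subtracting \<open>M\<close> keeps divisibility by \<open>2 ^ k\<close>, and
      the entry in column \<open>2 ^ k\<close> becomes the top of the quotient.\<close>
    define e' where "e' = e - M"
    have e': "e' \<in> {1..M}" "e' < M" "e = e' + M"
      using greater Suc.prems(2,3) by (auto simp: e'_def mem_A' N_eq)
    have "(2::nat) ^ k dvd M" using k by (simp add: le_imp_power_dvd)
    then have d: "2 ^ k dvd e'" using Suc.prems(4) by (simp add: e'_def)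
    have "(lop e' (2 ^ k)) mod M = 0" using cong_left[OF e'(1) kA] e'(3) Suc.prems(5) by (simp add: N_eq)
    then have "pmod (lop e' (2 ^ k)) M = M" by (simp add: pmod_def)
    then have "e' = M - 2 ^ k"
      using Suc.IH[OF quotient, of e'] e' d by (auto simp: laver_set_def)
    then show ?thesis using e' kM N_eq by linarith
  next
    case less
    \<comment> \<open>The quotient yields \<open>e = M - 2 ^ k\<close>. Then column
      \<open>2 ^ k\<close> turns out to carry \<open>M\<close> rather than \<open>N\<close>, so this
      case is impossible.\<close>
    have "pmod (lop e (2 ^ k)) M = M" using Suc.prems(5) by (simp add: pmod_def N_eq)
    then have eq: "e = M - 2 ^ k"
      using Suc.IH[OF quotient, of e] less e0 Suc.prems(4) by (auto simp: laver_set_def)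
    have "lop e i = e + i" if "1 \<le> i" "i \<le> 2 ^ k" for i
      using that
    proof (induction i rule: dec_induct)
      case base
      show ?case using right_one[of e] Suc.prems by simp
    next
      case (step i)
      define u where "u = e + i"
      have u: "u \<in> A" "u \<in> laver_set m" "u < M" "u + 2 ^ k > M" "i \<in> A" "i < N" "Suc e \<in> A" "u < N"
        using step.hyps step.prems eq kM e0 less
        unfolding u_def mem_A' laver_set_def N_eq atLeastAtMost_iff by linarith+
      obtain i' where i': "i' < k" "pmod (lop u (2 ^ i')) M = M"
        using Q.row_top_below[OF u(2) _ u(4,3)] k by auto
      have i'A: "2 ^ i' \<in> A" "2 ^ Suc i' \<in> A" using i'(1) k by (auto simp: mem_A)
      have "pmod (lop u (2 ^ Suc i')) M = M"
        using Q.row_top_mono[OF u(2), of i' "Suc i'"] i' k by simp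
      then have or: "lop u (2 ^ i') = M \<or> lop u (2 ^ i') = N" "lop u (2 ^ Suc i') = M \<or> lop u (2 ^ Suc i') = N"
        using i'(2) pmod_eq_top[of "lop u (2 ^ i')"] pmod_eq_top[of "lop u (2 ^ Suc i')"] u(1) i'A by simp_all
      \<comment> \<open>By \<open>row_top_repeat\<close> the columns \<open>2 ^ i'\<close> and
        \<open>2 ^ Suc i'\<close> cannot both carry \<open>M\<close>: lifting to the larger table at
        most doubles the period.\<close>
      have "lop u (2 ^ Suc i') = N"
      proof (cases "lop u (2 ^ i') = N")
        case True
        then show ?thesis using row_top_mono[OF u(1), of i' "Suc i'"] i'(1) k by simp
      next
        case False
        then show ?thesis using or row_top_repeat[OF u(1), of i'] i'(1) k by auto
      qed
      then have uk: "lop u (2 ^ k) = N" using row_top_mono[of u "Suc i'" k] u i' k by simp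
      \<comment> \<open>As \<open>2 ^ k\<close> divides \<open>e\<close>, column
        \<open>Suc e\<close> of row \<open>u\<close> agrees with column \<open>1\<close>.\<close>
      have "lop u (Suc e) = lop u 1"
        by (rule row_eq[OF u(1) _ uk]) (use u k Suc.prems(4) in \<open>auto simp: mod_Suc\<close>)
      then show ?case
        using right_Suc[of e i] right_one[of e] right_one[of u] u Suc.prems step by (simp add: u_def)
    qed
    from this[of "2 ^ k"] show ?thesis using eq Suc.prems(5) kM N_eq M_pos by linarith
  qed
qed

section \<open>The order of reachability\<close>

context laver
begin

lemma Min_row:
  assumes "x \<in> A" "x < N"
  shows "Min (lop x ` A) = x \<triangleright> 1"
proof (rule Min_eqI)
  fix v assume "v \<in> lop x ` A"
  then show "x \<triangleright> 1 \<le> v" using gt_left[OF assms] right_one[OF assms] by fastforce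
qed (use finite_A one_in in auto)

text \<open>Among the left translations other than the identity that fix \<open>x\<close>, one with smallest
  image is idempotent, since a left translation is determined by the minimum of its image.
  An idempotent has to be a multiple of its own period.\<close>

lemma fixed_point_large:
  assumes p: "p \<in> A" "p < N" "x \<in> A" "p \<triangleright> x = x"
  shows "2 * x > N"
proof -
  define S where "S = {s \<in> A. s < N \<and> s \<triangleright> x = x}"
  have "p \<in> S" using p by (simp add: S_def)
  then obtain s where s: "s \<in> S" "\<And>t. t \<in> S \<Longrightarrow> card (lop s ` A) \<le> card (lop t ` A)"
    using ex_has_least_nat[of "\<lambda>s. s \<in> S" p "\<lambda>s. card (lop s ` A)"] by auto
  then have sA: "s \<in> A" "s < N" "s \<triangleright> x = x" by (auto simp: S_def)
  \<comment> \<open>The square of row \<open>s\<close> fixes \<open>x\<close> too, and its image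
    lies inside that of \<open>s\<close>; by minimality the images agree.\<close>
  obtain t where t: "t \<in> A" "\<And>z. z \<in> A \<Longrightarrow> t \<triangleright> z = s \<triangleright> (s \<triangleright> z)"
    using ex_comp[OF sA(1) sA(1)] by metis
  have "t \<noteq> N"
  proof
    assume "t = N"
    then have "1 = s \<triangleright> (s \<triangleright> 1)" using t(2)[OF one_in(1)] top_one by simp
    moreover have "s < s \<triangleright> (s \<triangleright> 1)" "1 \<le> s"
      using gt_left[OF sA(1,2), of "s \<triangleright> 1"] sA(1) by (auto simp: mem_A[of s])
    ultimately show False by linarith
  qed
  then have tN: "t < N" using t(1) by (auto simp: mem_A)
  then have "t \<in> S" using t sA p(3) by (simp add: S_def)
  then have "card (lop s ` A) \<le> card (lop t ` A)" by (rule s(2))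
  moreover have "lop t ` A \<subseteq> lop s ` A" using t(2) sA(1) by auto
  ultimately have "lop t ` A = lop s ` A" using finite_A by (intro card_seteq) auto
  then have ts: "t \<triangleright> 1 = s \<triangleright> 1" using Min_row[OF t(1) tN] Min_row[OF sA(1,2)] by simp
  have Ss: "Suc s \<in> A" using sA by (auto simp: mem_A)
  \<comment> \<open>The left side is \<open>s \<triangleright> (s \<triangleright> 1)\<close>.
    Columns \<open>Suc s\<close> and \<open>1\<close> agree, so the period divides
    \<open>s\<close>.\<close>
  have eq: "s \<triangleright> Suc s = s \<triangleright> 1" using t(2)[OF one_in(1)] ts right_one[OF sA(1,2)] by simp
  obtain k where k: "k \<le> n"
    "\<And>y z. y \<in> A \<Longrightarrow> z \<in> A \<Longrightarrow> s \<triangleright> y = s \<triangleright> z \<longleftrightarrow> y mod 2 ^ k = z mod 2 ^ k"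
    "s + 2 ^ k \<le> N"
    using row_period[OF sA(1)] sA(2) by metis
  have "Suc s mod 2 ^ k = 1 mod 2 ^ k" using k(2)[OF Ss one_in(1)] eq by simp
  then have "2 ^ k dvd Suc s - 1" by (subst mod_eq_dvd_iff_nat[symmetric]) auto
  then have dvd: "2 ^ k dvd s" by simp
  have "(2::nat) ^ k \<in> A" using k(1) by (auto simp: mem_A)
  then have "s \<triangleright> 2 ^ k = N" using k(2)[of "2 ^ k" N] pow2_mod[OF k(1)] sA(1) by simp
  then have seq: "s = N - 2 ^ k"
    using period_of_multiple[OF laver_axioms sA(1,2) dvd] by simp
  \<comment> \<open>\<open>k = n\<close> would make \<open>s\<close> zero. Hence \<open>s\<close> is
    at least \<open>N / 2\<close>, and \<open>x = s \<triangleright> x\<close> exceeds it.\<close>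
  have "k < n" using seq k(1) sA(1) by (cases "k = n") (auto simp: mem_A)
  then have "2 * 2 ^ k \<le> N" using power_increasing[of "Suc k" n "2::nat"] by simp
  moreover have "s < x" using gt_left[OF sA(1,2) p(3)] sA(3) by simp
  ultimately show ?thesis using seq by linarith
qed

end

lemma translates_antisym:
  assumes "laver n lop" "x \<in> laver_set n" "y \<in> laver_set n" "p \<in> laver_set n" "r \<in> laver_set n"
    "x = lop p y" "y = lop r x"
  shows "x = y"
  using assms
proof (induction n arbitrary: lop x y p r)
  case 0
  show ?case using "0.prems"(2,3) unfolding laver_set_def by simp
next
  case (Suc m)
  note power_Suc [simp del]
  interpret laver_suc m lop by (rule laver_suc_intro[OF Suc.prems(1)])
  have "pmod x M = pmod (lop (pmod p M) (pmod y M)) M"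
    using pmod_cong[OF Suc.prems(4,3)] by (simp only: Suc.prems(6)[symmetric])
  moreover have "pmod y M = pmod (lop (pmod r M) (pmod x M)) M"
    using pmod_cong[OF Suc.prems(5,2)] by (simp only: Suc.prems(7)[symmetric])
  ultimately have "pmod x M = pmod y M"
    by (rule Suc.IH[OF quotient pmod_A(1) pmod_A(1) pmod_A(1) pmod_A(1)])
  then have eq: "x mod M = y mod M" by (simp only: pmod_eq_iff[OF M_pos])
  \<comment> \<open>Row \<open>p\<close> repeats after \<open>M\<close> columns, so it agrees at
    \<open>x\<close> and \<open>y\<close> and fixes \<open>x\<close>. Fixed points lie above
    \<open>M\<close>, where each class modulo \<open>M\<close> has a single member.\<close>
  have main: False if "x \<in> A" "y \<in> A" "p \<in> A" "x = lop p y" "x < y" "x mod M = y mod M" for x y p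
  proof -
    have "p \<noteq> N" using that(2,4,5) by auto
    then have p: "p < N" using that(3) by (auto simp: mem_A)
    have "lop p x = lop p y"
      by (rule row_eq[OF that(3) _ row_top_half[OF that(3) p refl]]) (use that(1,2,6) in auto)
    then have "lop p x = x" by (simp only: that(4)[symmetric])
    then have "2 * x > N" by (rule fixed_point_large[OF that(3) p that(1)])
    then have "M < x" by (simp add: N_eq)
    moreover have "y \<le> M + M" using that(2) by (simp add: mem_A')
    ultimately show False using mod_eq_close[OF that(6)] that(5) by linarith
  qed
  show ?case
    using main[OF Suc.prems(2,3,4,6) _ eq] main[OF Suc.prems(3,2,5,7) _ eq[symmetric]] nat_neq_iff
    by blast
qed

context laver
begin

definition reach :: "nat \<Rightarrow> nat \<Rightarrow> bool" where
  "reach y q \<longleftrightarrow> (\<exists>p\<in>A. q = p \<triangleright> y)"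

lemma reach_refl: "y \<in> A \<Longrightarrow> reach y y"
  unfolding reach_def by (rule bexI[of _ N]) auto

lemma reach_step: "x \<in> A \<Longrightarrow> y \<in> A \<Longrightarrow> reach (x \<triangleright> y) q \<Longrightarrow> reach y q"
  unfolding reach_def using ex_comp by metis

lemma reach_trans: "y \<in> A \<Longrightarrow> reach y q \<Longrightarrow> reach q q' \<Longrightarrow> reach y q'"
  using reach_step unfolding reach_def by metis

lemma reach_antisym: "x \<in> A \<Longrightarrow> y \<in> A \<Longrightarrow> reach x y \<Longrightarrow> reach y x \<Longrightarrow> x = y"
  unfolding reach_def using translates_antisym[OF laver_axioms] by metis

text \<open>\<open>pmod\<close> matters only for \<open>n = 0\<close>, where \<open>N - 1\<close> is
  not in the table. Either way this row is constantly \<open>N\<close>.\<close>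

definition pre_top :: nat where "pre_top = pmod (N - 1) N"

lemma pre_top_in: "pre_top \<in> A"
  using pmod_in[of N "N - 1"] by (simp add: laver_set_def pre_top_def)

lemma pre_top_left: "y \<in> A \<Longrightarrow> pre_top \<triangleright> y = N"
proof (cases "n = 0")
  case True
  assume "y \<in> A"
  then show ?thesis using closed[OF pre_top_in, of y] True by (simp add: laver_set_def)
next
  case False
  assume y: "y \<in> A"
  have "1 < N" using False by (intro one_less_power) auto
  then have "pre_top = N - 1" unfolding pre_top_def by (intro pmod_self) auto
  then have "N - 1 < pre_top \<triangleright> y"
    using gt_left[OF pre_top_in _ y] \<open>1 < N\<close> by simp
  then show ?thesis using closed[OF pre_top_in y] by (auto simp: mem_A)
qed

text \<open>As every element reaches \<open>N\<close>, the indicator attached to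
  \<open>q = N\<close> is constant and its coboundary vanishes; hence the basis stops at
  \<open>q < N\<close>.\<close>

lemma reach_top: "y \<in> A \<Longrightarrow> reach y N"
  unfolding reach_def using pre_top_left pre_top_in by metis

end

section \<open>Unitriangular integer systems and bases given by families\<close>

lemma triangular_ex:
  fixes h :: "'a \<Rightarrow> nat" and \<theta> :: "'a \<Rightarrow> int"
  assumes "finite S" "\<And>y. y \<in> S \<Longrightarrow> R y y"
    and "\<And>y q. y \<in> S \<Longrightarrow> q \<in> S \<Longrightarrow> R y q \<Longrightarrow> y \<noteq> q \<Longrightarrow> h q < h y"
  shows "\<exists>c. \<forall>y\<in>S. \<theta> y = (\<Sum>q\<in>S. c q * of_bool (R y q))"
  using assms
proof (induction S rule: finite_ranking_induct[where f = h])
  case empty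
  then show ?case by simp
next
  case (insert x S)
  then obtain c where c: "\<forall>y\<in>S. \<theta> y = (\<Sum>q\<in>S. c q * of_bool (R y q))" by auto
  show ?case
  proof (cases "x \<in> S")
    case True
    then show ?thesis using c by (auto simp: insert_absorb)
  next
    case False
    \<comment> \<open>No element of \<open>S\<close> has larger rank than \<open>x\<close>, so no
      earlier equation involves the coefficient of \<open>x\<close>, and its own equation contains
      it with factor one.\<close>
    define c' where "c' = c(x := \<theta> x - (\<Sum>q\<in>S. c q * of_bool (R x q)))"
    have "(\<Sum>q\<in>S. c' q * of_bool (R y q)) = (\<Sum>q\<in>S. c q * of_bool (R y q))" for y
      using False by (intro sum.cong) (auto simp: c'_def)
    moreover have "\<not> R y x" if "y \<in> S" for y
    proof
      assume "R y x"
      then have "h x < h y" using insert.prems(2)[of y x] that False by auto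
      then show False using insert.hyps(2)[OF that] by simp
    qed
    ultimately have "\<forall>y\<in>insert x S. \<theta> y = (\<Sum>q\<in>insert x S. c' q * of_bool (R y q))"
      using c insert.prems(1) insert.hyps(1) False by (auto simp: c'_def)
    then show ?thesis by blast
  qed
qed

text \<open>In the equation for \<open>y\<close> every other \<open>q\<close> with
  \<open>R y q\<close> has smaller rank and, by induction, coefficient zero.\<close>

lemma triangular_zero:
  fixes h :: "'a \<Rightarrow> nat" and c :: "'a \<Rightarrow> int"
  assumes "finite S" "\<And>y. y \<in> S \<Longrightarrow> R y y"
    and "\<And>y q. y \<in> S \<Longrightarrow> q \<in> S \<Longrightarrow> R y q \<Longrightarrow> y \<noteq> q \<Longrightarrow> h q < h y"
    and "\<And>y. y \<in> S \<Longrightarrow> (\<Sum>q\<in>S. c q * of_bool (R y q)) = 0"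
    and "y \<in> S"
  shows "c y = 0"
  using assms(5)
proof (induction "h y" arbitrary: y rule: less_induct)
  case less
  have "(\<Sum>q\<in>S - {y}. c q * of_bool (R y q)) = 0"
    using less assms(3) by (intro sum.neutral) auto
  moreover have "(\<Sum>q\<in>S. c q * of_bool (R y q)) = c y + (\<Sum>q\<in>S - {y}. c q * of_bool (R y q))"
    using assms(2)[OF less.prems] by (simp add: sum.remove[OF assms(1) less.prems])
  ultimately show ?case using assms(4)[OF less.prems] by simp
qed

lemma zmod_sum_apply: "(\<Sum>i\<in>I. zscale (c i) (b i)) z = (\<Sum>i\<in>I. c i * b i z)"
  by (induction I rule: infinite_finite_induct) (auto simp: zscale_def)

text \<open>Bases are sets, so a family must also be injective; this follows from independence with
  coefficients \<open>1\<close> at \<open>i\<close> and \<open>-1\<close> at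
  \<open>j\<close>.\<close>

lemma zbasis_family:
  fixes b :: "'i \<Rightarrow> 'a \<Rightarrow> int"
  assumes "finite I" "zmod.subspace M" "\<And>i. i \<in> I \<Longrightarrow> b i \<in> M"
    and indep: "\<And>c i. (\<And>z. (\<Sum>i\<in>I. c i * b i z) = 0) \<Longrightarrow> i \<in> I \<Longrightarrow> c i = 0"
    and span: "\<And>f. f \<in> M \<Longrightarrow> \<exists>c. \<forall>z. f z = (\<Sum>i\<in>I. c i * b i z)"
  shows "inj_on b I \<and> zbasis M (b ` I)"
proof -
  have inj: "inj_on b I"
  proof (rule inj_onI, rule ccontr)
    fix i j assume ij: "i \<in> I" "j \<in> I" "b i = b j" "i \<noteq> j"
    define c :: "'i \<Rightarrow> int" where "c = (\<lambda>k. of_bool (k = i) - of_bool (k = j))"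
    have "(\<Sum>k\<in>I. c k * b k z) = 0" for z
    proof -
      have "(\<Sum>k\<in>I. c k * b k z) = (\<Sum>k\<in>I. if k = i then b k z else 0) - (\<Sum>k\<in>I. if k = j then b k z else 0)"
        unfolding sum_subtractf[symmetric] by (intro sum.cong) (auto simp: c_def)
      then show ?thesis using ij assms(1) by simp
    qed
    from indep[of c i, OF this ij(1)] show False using ij by (simp add: c_def)
  qed
  have ind: "zmod.independent (b ` I)"
  proof -
    have "u (b i) = 0" if "(\<Sum>w\<in>b ` I. zscale (u w) w) = 0" "i \<in> I" for u i
    proof -
      have "(\<Sum>i\<in>I. zscale (u (b i)) (b i)) = 0" using that(1) by (simp add: sum.reindex[OF inj])
      then have "(\<Sum>i\<in>I. u (b i) * b i z) = 0" for z
        using zmod_sum_apply[of "\<lambda>i. u (b i)" b I z] by simp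
      from indep[of "\<lambda>i. u (b i)", OF this that(2)] show ?thesis .
    qed
    then show ?thesis using assms(1) by (auto simp: zmod.dependent_finite)
  qed
  have "zmod.span (b ` I) = M"
  proof
    show "zmod.span (b ` I) \<subseteq> M" using assms(2,3) by (intro zmod.span_minimal) auto
    show "M \<subseteq> zmod.span (b ` I)"
    proof
      fix f assume "f \<in> M"
      then obtain c where "\<forall>z. f z = (\<Sum>i\<in>I. c i * b i z)" using span by blast
      then have "f = (\<Sum>i\<in>I. zscale (c i) (b i))" by (auto simp: zmod_sum_apply)
      then show "f \<in> zmod.span (b ` I)"
        by (simp add: zmod.span_sum zmod.span_scale zmod.span_base)
    qed
  qed
  with inj ind assms(2) show ?thesis by (simp add: zbasis_def)
qed

section \<open>Cocycles are coboundaries up to a constant\<close>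

context laver
begin

text \<open>The identity without vanishing outside the table, so that it applies to slices and to
  coboundaries of arbitrary functions.\<close>

definition coc2 :: "(nat \<times> nat \<Rightarrow> int) \<Rightarrow> bool" where
  "coc2 \<alpha> \<longleftrightarrow> (\<forall>x\<in>A. \<forall>y\<in>A. \<forall>z\<in>A.
     \<alpha> (x \<triangleright> y, x \<triangleright> z) + \<alpha> (x, z) = \<alpha> (x, y \<triangleright> z) + \<alpha> (y, z))"

lemma coc2D:
  assumes "coc2 \<alpha>" "x \<in> A" "y \<in> A" "z \<in> A"
  shows "\<alpha> (x \<triangleright> y, x \<triangleright> z) + \<alpha> (x, z) = \<alpha> (x, y \<triangleright> z) + \<alpha> (y, z)"
  using assms by (simp add: coc2_def)

lemma A_cases [consumes 1, case_names one Suc]: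
  assumes "y \<in> A"
  obtains "y = 1" | y' where "y = Suc y'" "y' \<in> A" "y' < N" "y = y' \<triangleright> 1"
proof (cases "y = 1")
  case False
  then have "y - 1 \<in> A" "y - 1 < N" "y = Suc (y - 1)" using assms by (auto simp: mem_A)
  then show ?thesis using that(2)[of "y - 1"] right_one[of "y - 1"] by simp
qed (use that in blast)

lemma coc2_zero:
  assumes c: "coc2 \<alpha>" and one: "\<And>x. x \<in> A \<Longrightarrow> \<alpha> (x, 1) = 0" and "x \<in> A" "y \<in> A"
  shows "\<alpha> (x, y) = 0"
  using \<open>x \<in> A\<close> \<open>y \<in> A\<close>
proof (induction x arbitrary: y rule: A_descend)
  case (above x)
  note x = above.hyps
  from \<open>y \<in> A\<close> show ?case
  proof (cases rule: A_cases)
    case one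
    then show ?thesis using assms(2) x by simp
  next
    case (Suc y')
    have eq: "\<alpha> (x, y) = \<alpha> (x \<triangleright> y', x \<triangleright> 1)"
      using coc2D[OF c x Suc(2) one_in(1)] one[OF x] one[OF Suc(2)] Suc(4) by simp
    show ?thesis
    proof (cases "x = N")
      case True
      \<comment> \<open>Row \<open>N\<close> allows no descent, but
        \<open>N \<triangleright> 1 = 1\<close> leads straight back to column
        \<open>1\<close>.\<close>
      then show ?thesis using eq one[OF Suc(2)] Suc(2) top_one by simp
    next
      case False
      then have "x < N" using x by (auto simp: mem_A)
      then show ?thesis
        using above.IH[of "x \<triangleright> y'" "x \<triangleright> 1"] gt_left[of x y'] x Suc(2) eq by auto
    qed
  qed
qed

lemma coc2_coboundary: "coc2 (\<lambda>(x, y). c + \<theta> (x \<triangleright> y) - \<theta> y)"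
  unfolding coc2_def
proof (intro ballI)
  fix x y z assume "x \<in> A" "y \<in> A" "z \<in> A"
  then show "(case (x \<triangleright> y, x \<triangleright> z) of (x, y) \<Rightarrow> c + \<theta> (x \<triangleright> y) - \<theta> y) + (case (x, z) of (x, y) \<Rightarrow> c + \<theta> (x \<triangleright> y) - \<theta> y) =
    (case (x, y \<triangleright> z) of (x, y) \<Rightarrow> c + \<theta> (x \<triangleright> y) - \<theta> y) + (case (y, z) of (x, y) \<Rightarrow> c + \<theta> (x \<triangleright> y) - \<theta> y)"
    using ld[of x y z, symmetric] by simp
qed

lemma coc2_form:
  assumes c: "coc2 \<alpha>"
  obtains \<theta> where "\<And>x y. x \<in> A \<Longrightarrow> y \<in> A \<Longrightarrow> \<alpha> (x, y) = \<alpha> (N, 1) + \<theta> (x \<triangleright> y) - \<theta> y"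
proof -
  \<comment> \<open>Forced by \<open>\<alpha> (x, 1) = \<alpha> (N, 1) + \<theta> (x
    \<triangleright> 1) - \<theta> 1\<close> and \<open>\<theta> 1 = 0\<close>: for
    \<open>u \<noteq> 1\<close>, \<open>u - 1\<close> is the \<open>x\<close> with
    \<open>x \<triangleright> 1 = u\<close>.\<close>
  define \<theta> where "\<theta> u = (if u = 1 then 0 else \<alpha> (u - 1, 1) - \<alpha> (N, 1))" for u
  define \<beta> where "\<beta> = (\<lambda>(x, y). \<alpha> (x, y) - (\<alpha> (N, 1) + \<theta> (x \<triangleright> y) - \<theta> y))"
  have "coc2 \<beta>"
    using c coc2_coboundary[of "\<alpha> (N, 1)" \<theta>] unfolding coc2_def \<beta>_def by (auto simp: algebra_simps)
  moreover have "\<beta> (x, 1) = 0" if "x \<in> A" for x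
  proof (cases "x = N")
    case True
    then show ?thesis using top_one by (simp add: \<beta>_def)
  next
    case False
    then have "x < N" using that by (auto simp: mem_A)
    then have "x \<triangleright> 1 = Suc x" using that right_one by simp
    then show ?thesis using that by (auto simp: \<beta>_def \<theta>_def mem_A)
  qed
  ultimately have zero: "\<beta> (x, y) = 0" if "x \<in> A" "y \<in> A" for x y using coc2_zero that by blast
  have "\<alpha> (x, y) = \<alpha> (N, 1) + \<theta> (x \<triangleright> y) - \<theta> y" if "x \<in> A" "y \<in> A" for x y
    using zero[OF that] unfolding \<beta>_def by simp
  then show ?thesis by (rule that)
qed

lemma coc2_top:
  assumes "coc2 \<alpha>" "x \<in> A"
  shows "\<alpha> (x, N) = \<alpha> (N, 1)" "\<alpha> (N, x) = \<alpha> (N, 1)"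
proof -
  obtain \<theta> where \<theta>: "\<And>x y. x \<in> A \<Longrightarrow> y \<in> A \<Longrightarrow> \<alpha> (x, y) = \<alpha> (N, 1) + \<theta> (x \<triangleright> y) - \<theta> y"
    using coc2_form[OF assms(1)] by metis
  show "\<alpha> (x, N) = \<alpha> (N, 1)" using \<theta>[of x N] assms(2) by simp
  show "\<alpha> (N, x) = \<alpha> (N, 1)" using \<theta>[of N x] assms(2) by simp
qed

text \<open>Row \<open>pre_top\<close> of the table is constantly \<open>N\<close>, so the identity
  at \<open>(pre_top, x, y)\<close> gives \<open>\<alpha> (x, y) = \<alpha> (N, N)\<close> once that
  row of \<open>\<alpha>\<close> is zero. The constant itself occurs in that row.\<close>

lemma coc2_zero_row:
  assumes c: "coc2 \<alpha>" and row: "\<And>y. y \<in> A \<Longrightarrow> \<alpha> (pre_top, y) = 0" and "x \<in> A" "y \<in> A"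
  shows "\<alpha> (x, y) = 0"
proof -
  have const: "\<alpha> (x, y) = \<alpha> (N, N)" if "x \<in> A" "y \<in> A" for x y
  proof -
    have "\<alpha> (N, N) + 0 = 0 + \<alpha> (x, y)"
      using coc2D[OF c pre_top_in that]
      unfolding pre_top_left[OF that(1)] pre_top_left[OF that(2)] row[OF that(2)] row[OF closed[OF that]] .
    then show ?thesis by simp
  qed
  have "\<alpha> (N, N) = 0" using const[OF pre_top_in top_in] row[OF top_in] by simp
  then show ?thesis using const[OF assms(3,4)] by simp
qed

section \<open>Cocycles in degree 3\<close>

definition coc3 :: "(nat \<times> nat \<times> nat \<Rightarrow> int) \<Rightarrow> bool" where
  "coc3 \<phi> \<longleftrightarrow> (\<forall>x\<in>A. \<forall>y\<in>A. \<forall>z\<in>A. \<forall>t\<in>A.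
       \<phi> (x \<triangleright> y, x \<triangleright> z, x \<triangleright> t) + \<phi> (x, y, z \<triangleright> t) + \<phi> (x, z, t) =
       \<phi> (x, y \<triangleright> z, y \<triangleright> t) + \<phi> (y, z, t) + \<phi> (x, y, t))"

lemma coc3D:
  assumes "coc3 \<phi>" "x \<in> A" "y \<in> A" "z \<in> A" "t \<in> A"
  shows "\<phi> (x \<triangleright> y, x \<triangleright> z, x \<triangleright> t) + \<phi> (x, y, z \<triangleright> t) + \<phi> (x, z, t) =
       \<phi> (x, y \<triangleright> z, y \<triangleright> t) + \<phi> (y, z, t) + \<phi> (x, y, t)"
  using assms by (simp add: coc3_def)

text \<open>\<open>cobound3\<close> without restriction to the table; \<open>d3 \<theta>\<close>
  vanishes on the table exactly when \<open>coc2 \<theta>\<close> holds.\<close>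

definition d3 :: "(nat \<times> nat \<Rightarrow> int) \<Rightarrow> nat \<times> nat \<times> nat \<Rightarrow> int" where
  "d3 \<theta> = (\<lambda>(x, y, z). \<theta> (x \<triangleright> y, x \<triangleright> z) + \<theta> (x, z) - \<theta> (x, y \<triangleright> z) - \<theta> (y, z))"

lemma coc3_coboundary: "coc3 (d3 \<theta>)"
  unfolding coc3_def
proof (intro ballI)
  fix x y z t assume "x \<in> A" "y \<in> A" "z \<in> A" "t \<in> A"
  then show "d3 \<theta> (x \<triangleright> y, x \<triangleright> z, x \<triangleright> t) + d3 \<theta> (x, y, z \<triangleright> t) + d3 \<theta> (x, z, t) =
       d3 \<theta> (x, y \<triangleright> z, y \<triangleright> t) + d3 \<theta> (y, z, t) + d3 \<theta> (x, y, t)"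
    using ld[of x y z, symmetric] ld[of x y t, symmetric] ld[of x z t, symmetric] ld[of y z t, symmetric]
    by (simp add: d3_def)
qed

text \<open>Descent in \<open>x\<close> removes the term with first entry
  \<open>x \<triangleright> y\<close>. The relation \<open>skew\<close> that remains moves
  \<open>y\<close> upwards, as in \<open>coc2_zero\<close>.\<close>

lemma coc3_zero:
  assumes c: "coc3 \<phi>" and one: "\<And>x y. x \<in> A \<Longrightarrow> y \<in> A \<Longrightarrow> \<phi> (x, y, 1) = 0"
    and "x \<in> A" "y \<in> A" "z \<in> A"
  shows "\<phi> (x, y, z) = 0"
  using \<open>x \<in> A\<close> \<open>y \<in> A\<close> \<open>z \<in> A\<close>
proof (induction x arbitrary: y z rule: A_descend)
  case (above x)
  note x = above.hyps and IHx = above.IH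
  have skew: "\<phi> (x, y, z \<triangleright> 1) = \<phi> (x, y \<triangleright> z, y \<triangleright> 1)" if "y \<in> A" "z \<in> A" for y z
  proof -
    have "\<phi> (x \<triangleright> y, x \<triangleright> z, x \<triangleright> 1) = 0"
    proof (cases "x = N")
      case True
      then show ?thesis using one that top_one by simp
    next
      case False
      then have "x < N" using x by (auto simp: mem_A)
      then show ?thesis using IHx[of "x \<triangleright> y" "x \<triangleright> z" "x \<triangleright> 1"] gt_left[of x y] x that by auto
    qed
    then show ?thesis using coc3D[OF c x that one_in(1)] one x that by simp
  qed
  show ?case using \<open>y \<in> A\<close> \<open>z \<in> A\<close>
  proof (induction y arbitrary: z rule: A_descend)
    case (above y)
    note y = above.hyps
    from \<open>z \<in> A\<close> show ?case
    proof (cases rule: A_cases)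
      case one
      then show ?thesis using assms(2) x y by simp
    next
      case (Suc z')
      have eq: "\<phi> (x, y, z) = \<phi> (x, y \<triangleright> z', y \<triangleright> 1)" using skew[OF y Suc(2)] Suc(4) by simp
      show ?thesis
      proof (cases "y = N")
        case True
        then show ?thesis using eq one[OF x Suc(2)] Suc(2) top_one by simp
      next
        case False
        then have "y < N" using y by (auto simp: mem_A)
        then show ?thesis
          using above.IH[of "y \<triangleright> z'" "y \<triangleright> 1"] gt_left[of y z'] y Suc(2) eq by auto
      qed
    qed
  qed
qed

lemma coc3_constraint:
  assumes c: "coc3 \<phi>" and x: "x \<in> A"
  shows "\<phi> (x, N, 1) + \<phi> (N, x, 1) = 2 * \<phi> (N, N, 1)"
proof -
  define \<alpha> where "\<alpha> = (\<lambda>(y, t). \<phi> (N, y, t))"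
  define \<gamma> where "\<gamma> = (\<lambda>(y, t). \<phi> (y, N, t))"
  have \<alpha>: "coc2 \<alpha>" unfolding coc2_def \<alpha>_def
  proof (clarsimp)
    fix x y z assume "x \<in> A" "y \<in> A" "z \<in> A"
    then show "\<phi> (N, x \<triangleright> y, x \<triangleright> z) + \<phi> (N, x, z) = \<phi> (N, x, y \<triangleright> z) + \<phi> (N, y, z)"
      using coc3D[OF c top_in, of x y z] by simp
  qed
  have \<gamma>: "coc2 \<gamma>" unfolding coc2_def \<gamma>_def
  proof (clarsimp)
    fix x y z assume "x \<in> A" "y \<in> A" "z \<in> A"
    then show "\<phi> (x \<triangleright> y, N, x \<triangleright> z) + \<phi> (x, N, z) = \<phi> (x, N, y \<triangleright> z) + \<phi> (y, N, z)"
      using coc3D[OF c, of x y N z] by simp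
  qed
  \<comment> \<open>With \<open>z \<triangleright> 1 = N\<close> both identities below reach column
    \<open>N\<close>, where \<open>coc2_top\<close> evaluates the slices. In the 3-cocycle identity
    at \<open>(x, N, z, 1)\<close> the term \<open>\<phi> (x, z, 1)\<close> cancels.\<close>
  obtain z where z: "z \<in> A" "z \<triangleright> 1 = N" using ex_succ[OF top_in] by metis
  have "\<alpha> (x \<triangleright> z, x \<triangleright> 1) + \<gamma> (x, z \<triangleright> 1) = \<alpha> (z, 1) + \<gamma> (x, 1)"
    using coc3D[OF c x top_in z(1) one_in(1)] x z(1) top_one by (simp add: \<alpha>_def \<gamma>_def)
  moreover have "\<alpha> (x \<triangleright> z, x \<triangleright> 1) + \<alpha> (x, 1) = \<alpha> (x, N) + \<alpha> (z, 1)"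
    using coc2D[OF \<alpha> x z(1) one_in(1)] z by simp
  ultimately have "\<gamma> (x, 1) + \<alpha> (x, 1) = \<gamma> (x, N) + \<alpha> (x, N)" using z by simp
  then show ?thesis
    using coc2_top(1)[OF \<alpha> x] coc2_top(1)[OF \<gamma> x] by (simp add: \<alpha>_def \<gamma>_def)
qed

end

text \<open>The recursion solves for \<open>\<theta> (x, y + 1)\<close> in \<open>d3 \<theta> (x, y, 1) = g x y\<close> under the
  normalisation \<open>\<theta> (x, 1) = 0\<close>. In a Laver table the
  inequality \<open>x < lop x (y - 1)\<close> holds whenever \<open>x < b = 2 ^ n\<close>.\<close>

function solve3 :: "nat \<Rightarrow> (nat \<Rightarrow> nat \<Rightarrow> nat) \<Rightarrow> (nat \<Rightarrow> nat \<Rightarrow> int) \<Rightarrow> nat \<Rightarrow> nat \<Rightarrow> int" where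
  "solve3 b lop g x y =
     (if y = 1 then 0
      else if x < b \<and> x < lop x (y - 1) then solve3 b lop g (lop x (y - 1)) (Suc x) - g x (y - 1)
      else - g x (y - 1))"
  by auto
termination by (relation "measure (\<lambda>(b, lop, g, x, y). b - x)") auto

declare solve3.simps [simp del]

context laver
begin

lemma coc3_form:
  assumes c: "coc3 \<phi>"
  obtains \<theta> where "\<And>x y z. x \<in> A \<Longrightarrow> y \<in> A \<Longrightarrow> z \<in> A \<Longrightarrow>
    \<phi> (x, y, z) = \<phi> (N, N, 1) + d3 \<theta> (x, y, z)"
proof -
  define g where "g x y = \<phi> (x, y, 1) - \<phi> (N, N, 1)" for x y
  define \<theta> where "\<theta> = (\<lambda>(x, y). solve3 N lop g x y)"
  have gN: "g x N + g N x = 0" if "x \<in> A" for x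
    using coc3_constraint[OF c that] by (simp add: g_def)
  have one: "\<theta> (x, 1) = 0" for x by (simp add: \<theta>_def solve3.simps)
  have top: "\<theta> (N, Suc y) = - g N y" if "y \<in> A" for y
    using that by (simp add: \<theta>_def solve3.simps[of _ _ _ N] mem_A)
  have rec: "\<theta> (x, Suc y) = \<theta> (x \<triangleright> y, Suc x) - g x y" if "x \<in> A" "y \<in> A" "x < N" for x y
    using that gt_left[of x y] by (simp add: \<theta>_def solve3.simps[of _ _ _ x] mem_A[of y])
  have d: "d3 \<theta> (x, y, 1) = g x y" if "x \<in> A" "y \<in> A" for x y
  proof -
    have d: "d3 \<theta> (x, y, 1) = \<theta> (x \<triangleright> y, x \<triangleright> 1) - \<theta> (x, y \<triangleright> 1)" by (simp add: d3_def one[simplified])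
    have gNN: "g N N = 0" by (simp add: g_def)
    have "x = N \<or> x < N" "y = N \<or> y < N" using that by (auto simp: mem_A)
    then consider "x = N" "y = N" | "x = N" "y < N" | "x < N" "y = N" | "x < N" "y < N"
      by blast
    then show ?thesis
    proof cases
      case 1
      then show ?thesis using d gNN top_one one[of N] by simp
    next
      case 2
      then show ?thesis using d top_one one[of y] right_one[of y] top[of y] that by simp
    next
      \<comment> \<open>The recursion has already fixed
        \<open>\<theta> (N, Suc x) = - g N x\<close>, and this must equal \<open>g x N\<close>: here
        the constraint \<open>gN\<close> enters.\<close>
      case 3
      then show ?thesis using d top_one one[of x] right_one[of x] top[of x] gN[of x] that by simp
    next
      case 4
      then show ?thesis using d right_one[of x] right_one[of y] rec[of x y] that by simp
    qed
  qed
  define \<beta> where "\<beta> = (\<lambda>z. \<phi> z - \<phi> (N, N, 1) - d3 \<theta> z)"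
  have coc: "coc3 \<beta>" unfolding coc3_def
  proof (intro ballI)
    fix x y z t assume "x \<in> A" "y \<in> A" "z \<in> A" "t \<in> A"
    then show "\<beta> (x \<triangleright> y, x \<triangleright> z, x \<triangleright> t) + \<beta> (x, y, z \<triangleright> t) + \<beta> (x, z, t) =
       \<beta> (x, y \<triangleright> z, y \<triangleright> t) + \<beta> (y, z, t) + \<beta> (x, y, t)"
      using coc3D[OF c, of x y z t] coc3D[OF coc3_coboundary, of x y z t \<theta>] by (simp add: \<beta>_def)
  qed
  have one': "\<beta> (x, y, 1) = 0" if "x \<in> A" "y \<in> A" for x y
    using d[OF that] by (simp add: \<beta>_def g_def)
  have zero: "\<beta> (x, y, z) = 0" if "x \<in> A" "y \<in> A" "z \<in> A" for x y z
    by (rule coc3_zero[OF coc one' that])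
  have "\<phi> (x, y, z) = \<phi> (N, N, 1) + d3 \<theta> (x, y, z)" if "x \<in> A" "y \<in> A" "z \<in> A" for x y z
    using zero[OF that] unfolding \<beta>_def by simp
  then show ?thesis by (rule that)
qed

lemma coc3_form_reduced:
  assumes c: "coc3 \<phi>"
  obtains \<theta> where "\<And>x y z. x \<in> A \<Longrightarrow> y \<in> A \<Longrightarrow> z \<in> A \<Longrightarrow>
    \<phi> (x, y, z) = \<phi> (N, N, 1) + d3 \<theta> (x, y, z)"
    "\<And>y. y \<in> A \<Longrightarrow> \<theta> (pre_top, y) = 0"
proof -
  obtain \<theta> where \<theta>: "\<And>x y z. x \<in> A \<Longrightarrow> y \<in> A \<Longrightarrow> z \<in> A \<Longrightarrow>
    \<phi> (x, y, z) = \<phi> (N, N, 1) + d3 \<theta> (x, y, z)" using coc3_form[OF c] by metis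
  \<comment> \<open>A 2-cocycle agreeing with \<open>\<theta>\<close> in row \<open>pre_top\<close>,
    since \<open>pre_top \<triangleright> y = N\<close>. Subtracting it leaves
    \<open>d3 \<theta>\<close> unchanged on the table.\<close>
  define \<kappa> where "\<kappa> = (\<lambda>(x, y). \<theta> (pre_top, N) + - \<theta> (pre_top, x \<triangleright> y) - - \<theta> (pre_top, y))"
  have \<kappa>: "coc2 \<kappa>" unfolding \<kappa>_def by (rule coc2_coboundary)
  define \<theta>' where "\<theta>' = (\<lambda>z. \<theta> z - \<kappa> z)"
  have "\<phi> (x, y, z) = \<phi> (N, N, 1) + d3 \<theta>' (x, y, z)" if "x \<in> A" "y \<in> A" "z \<in> A" for x y z
    using coc2D[OF \<kappa> that] \<theta>[OF that] by (simp add: d3_def \<theta>'_def)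
  moreover have "\<theta>' (pre_top, y) = 0" if "y \<in> A" for y
    using that by (simp add: \<theta>'_def \<kappa>_def pre_top_left)
  ultimately show ?thesis by (rule that)
qed

end

section \<open>Bases\<close>

lemma sum_adjoin_None:
  fixes f :: "'b option \<Rightarrow> int"
  shows "finite J \<Longrightarrow> (\<Sum>i\<in>insert None (Some ` J). f i) = f None + (\<Sum>j\<in>J. f (Some j))"
  by (simp add: sum.reindex)

context laver
begin

lemma A_insert: "A = insert N {1..<N}"
  by (auto simp: mem_A)

lemma cocycles2_eq: "cocycles2 n lop = {\<phi> \<in> zmaps (laver_pairs n). coc2 \<phi>}"
  by (simp add: cocycles2_def coc2_def)

lemma cocycles3_eq: "cocycles3 n lop = {\<phi> \<in> zmaps (laver_triples n). coc3 \<phi>}"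
  by (simp add: cocycles3_def coc3_def)

lemma subspace2: "zmod.subspace (cocycles2 n lop)"
proof -
  have "coc2 (f + g)" if "coc2 f" "coc2 g" for f g
    unfolding coc2_def
  proof (intro ballI)
    fix x y z assume "x \<in> A" "y \<in> A" "z \<in> A"
    from coc2D[OF that(1) this] coc2D[OF that(2) this]
    show "(f + g) (x \<triangleright> y, x \<triangleright> z) + (f + g) (x, z) = (f + g) (x, y \<triangleright> z) + (f + g) (y, z)"
      by simp
  qed
  moreover have "coc2 (zscale c f)" if "coc2 f" for c f
    using that by (auto simp: coc2_def zscale_def simp flip: distrib_left)
  moreover have "coc2 0" by (simp add: coc2_def)
  ultimately show ?thesis
    by (auto simp: zmod.subspace_def cocycles2_eq zmaps_def zscale_def)
qed

lemma subspace3: "zmod.subspace (cocycles3 n lop)"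
proof -
  have "coc3 (f + g)" if "coc3 f" "coc3 g" for f g
    unfolding coc3_def
  proof (intro ballI)
    fix x y z t assume "x \<in> A" "y \<in> A" "z \<in> A" "t \<in> A"
    from coc3D[OF that(1) this] coc3D[OF that(2) this]
    show "(f + g) (x \<triangleright> y, x \<triangleright> z, x \<triangleright> t) + (f + g) (x, y, z \<triangleright> t) + (f + g) (x, z, t) =
       (f + g) (x, y \<triangleright> z, y \<triangleright> t) + (f + g) (y, z, t) + (f + g) (x, y, t)"
      by simp
  qed
  moreover have "coc3 (zscale c f)" if "coc3 f" for c f
    using that by (auto simp: coc3_def zscale_def simp flip: distrib_left)
  moreover have "coc3 0" by (simp add: coc3_def)
  ultimately show ?thesis
    by (auto simp: zmod.subspace_def cocycles3_eq zmaps_def zscale_def)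
qed

lemma const2_cocycle: "const2 n \<in> cocycles2 n lop"
  by (auto simp: cocycles2_def const2_def zmap_on_def zmaps_def)

lemma const3_cocycle: "const3 n \<in> cocycles3 n lop"
  by (auto simp: cocycles3_def const3_def zmap_on_def zmaps_def)

text \<open>By \<open>reach_step\<close>, \<open>y\<close> reaches whatever
  \<open>x \<triangleright> y\<close> reaches, so the condition in \<open>psi\<close> becomes a
  difference of indicators.\<close>

lemma psi_apply:
  assumes "x \<in> A" "y \<in> A"
  shows "psi n lop q (x, y) = of_bool (reach y q) - of_bool (reach (x \<triangleright> y) q)"
  using reach_step[OF assms] assms by (auto simp: psi_def zmap_on_def reach_def[symmetric])

lemma psi_coboundary: "psi n lop q \<in> coboundaries2 n lop"
proof -
  have "psi n lop q = cobound2 n lop (zmap_on A (\<lambda>y. - of_bool (reach y q)))"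
  proof
    fix z
    show "psi n lop q z = cobound2 n lop (zmap_on A (\<lambda>y. - of_bool (reach y q))) z"
    proof (cases "z \<in> laver_pairs n")
      case True
      then obtain x y where "z = (x, y)" "x \<in> A" "y \<in> A" by auto
      then show ?thesis using psi_apply[of x y q] by (simp add: cobound2_def zmap_on_def)
    next
      case False
      then show ?thesis by (simp add: psi_def cobound2_def zmap_on_def)
    qed
  qed
  moreover have "zmap_on A (\<lambda>y. - of_bool (reach y q)) \<in> zmaps A"
    by (simp add: zmap_on_def zmaps_def)
  ultimately show ?thesis unfolding coboundaries2_def by blast
qed

lemma psi_cocycle: "psi n lop q \<in> cocycles2 n lop"
proof -
  define \<beta> :: "nat \<times> nat \<Rightarrow> int" where "\<beta> = (\<lambda>(x, y). 0 + - of_bool (reach (x \<triangleright> y) q) - - of_bool (reach y q))"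
  have "coc2 \<beta>" unfolding \<beta>_def by (rule coc2_coboundary)
  moreover have "psi n lop q (x, y) = \<beta> (x, y)" if "x \<in> A" "y \<in> A" for x y
    using psi_apply[OF that] by (simp add: \<beta>_def)
  ultimately have "coc2 (psi n lop q)" by (simp add: coc2_def)
  moreover have "psi n lop q \<in> zmaps (laver_pairs n)"
    by (simp add: psi_def zmap_on_def zmaps_def)
  ultimately show ?thesis by (simp add: cocycles2_eq)
qed

text \<open>The size of an up-set, used as the rank in the triangular systems.\<close>

definition rk :: "nat \<Rightarrow> nat" where "rk y = card {q \<in> A. reach y q}"

lemma rk_less:
  assumes "y \<in> A" "q \<in> A" "reach y q" "y \<noteq> q"
  shows "rk q < rk y"
  unfolding rk_def
proof (rule psubset_card_mono)
  show "finite {q \<in> A. reach y q}" using finite_A by simp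
  have "{q' \<in> A. reach q q'} \<subseteq> {q \<in> A. reach y q}" using reach_trans[OF assms(1,3)] by auto
  moreover have "y \<in> {q \<in> A. reach y q}" "y \<notin> {q' \<in> A. reach q q'}"
    using assms reach_refl reach_antisym by auto
  ultimately show "{q' \<in> A. reach q q'} \<subset> {q \<in> A. reach y q}" by blast
qed

text \<open>\<open>None\<close> indexes the constant cocycle; injectivity of the family then also
  separates it from the coboundaries.\<close>

definition basis2 :: "nat option \<Rightarrow> nat \<times> nat \<Rightarrow> int" where
  "basis2 = case_option (const2 n) (psi n lop)"

definition basis3 :: "(nat \<times> nat) option \<Rightarrow> nat \<times> nat \<times> nat \<Rightarrow> int" where
  "basis3 = case_option (const3 n) (phi3 n lop)"

section \<open>Independence and generation in degree 2\<close>

lemma basis2_indep: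
  assumes zero: "\<And>z. (\<Sum>i\<in>insert None (Some ` {1..<N}). c i * basis2 i z) = 0"
    and i: "i \<in> insert None (Some ` {1..<N})"
  shows "c i = 0"
proof -
  define F where "F y = (\<Sum>q\<in>{1..<N}. c (Some q) * of_bool (reach y q))" for y
  have sum0: "c None + F y - F (x \<triangleright> y) = 0" if "x \<in> A" "y \<in> A" for x y
  proof -
    have "c None * const2 n (x, y) + (\<Sum>q\<in>{1..<N}. c (Some q) * psi n lop q (x, y)) = 0"
      using zero[of "(x, y)"] by (simp only: sum_adjoin_None finite_atLeastLessThan basis2_def option.case)
    then show ?thesis
      using that by (simp add: psi_apply const2_def zmap_on_def F_def right_diff_distrib sum_subtractf)
  qed
  have None: "c None = 0" using sum0[of N 1] top_one by simp
  have const: "F u = F 1" if u: "u \<in> A" for u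
  proof -
    obtain w where "w \<in> A" "w \<triangleright> 1 = u" using ex_succ[OF u] by metis
    then show ?thesis using sum0[of w 1] None by simp
  qed
  \<comment> \<open>The value of the constant function \<open>F\<close> is absorbed into a
    coefficient at \<open>N\<close>, which every element reaches. This gives a homogeneous
    triangular system over all of \<open>A\<close>.\<close>
  define c' where "c' q = (if q = N then - F 1 else c (Some q))" for q
  have zero': "(\<Sum>q\<in>A. c' q * of_bool (reach y q)) = 0" if "y \<in> A" for y
  proof -
    have "(\<Sum>q\<in>A. c' q * of_bool (reach y q)) = - F 1 + (\<Sum>q\<in>{1..<N}. c' q * of_bool (reach y q))"
      unfolding A_insert using reach_top[OF that] by (simp add: c'_def)
    also have "(\<Sum>q\<in>{1..<N}. c' q * of_bool (reach y q)) = F y"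
      unfolding F_def by (intro sum.cong) (auto simp: c'_def)
    finally show ?thesis using const[OF that] by simp
  qed
  have "c' q = 0" if "q \<in> A" for q
    using triangular_zero[where R = reach and h = rk and S = A, OF finite_A reach_refl rk_less zero' that] .
  then have "c (Some q) = 0" if "q \<in> {1..<N}" for q
    using that by (fastforce simp: c'_def A_insert)
  then show ?thesis using i None by auto
qed

lemma basis2_span:
  assumes "\<phi> \<in> cocycles2 n lop"
  shows "\<exists>c. \<forall>z. \<phi> z = (\<Sum>i\<in>insert None (Some ` {1..<N}). c i * basis2 i z)"
proof -
  have "coc2 \<phi>" using assms by (simp add: cocycles2_eq)
  then obtain \<theta> where \<theta>: "\<And>x y. x \<in> A \<Longrightarrow> y \<in> A \<Longrightarrow> \<phi> (x, y) = \<phi> (N, 1) + \<theta> (x \<triangleright> y) - \<theta> y"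
    using coc2_form by metis
  \<comment> \<open>\<open>psi\<close> is minus a coboundary, hence the sign of
    \<open>\<theta>\<close>.\<close>
  obtain c where c: "\<forall>y\<in>A. - \<theta> y = (\<Sum>q\<in>A. c q * of_bool (reach y q))"
    using triangular_ex[where R = reach and h = rk and S = A and \<theta> = "\<lambda>y. - \<theta> y", OF finite_A reach_refl rk_less]
    by auto
  define d where "d = case_option (\<phi> (N, 1)) c"
  have "\<phi> z = (\<Sum>i\<in>insert None (Some ` {1..<N}). d i * basis2 i z)" for z
  proof (cases "z \<in> laver_pairs n")
    case True
    then obtain x y where z: "z = (x, y)" "x \<in> A" "y \<in> A" by auto
    have "\<phi> z = \<phi> (N, 1) + - \<theta> y - - \<theta> (x \<triangleright> y)" using \<theta>[OF z(2,3)] z by simp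
    also have "\<dots> = \<phi> (N, 1) + (\<Sum>q\<in>A. c q * psi n lop q (x, y))"
      using c z by (simp add: psi_apply right_diff_distrib sum_subtractf)
    also have "(\<Sum>q\<in>A. c q * psi n lop q (x, y)) = (\<Sum>q\<in>{1..<N}. c q * psi n lop q (x, y))"
      unfolding A_insert using z reach_top by (simp add: psi_apply)
    finally show ?thesis
      using z by (subst sum_adjoin_None) (simp_all add: basis2_def d_def const2_def zmap_on_def)
  next
    case False
    then have "\<phi> z = 0" using assms unfolding cocycles2_def zmaps_def by blast
    then show ?thesis
      using False by (subst sum_adjoin_None) (simp_all add: basis2_def const2_def psi_def zmap_on_def)
  qed
  then show ?thesis by blast
qed

lemma basis2_zbasis:
  "inj_on basis2 (insert None (Some ` {1..<N})) \<and>
   zbasis (cocycles2 n lop) (basis2 ` insert None (Some ` {1..<N}))"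
proof (rule zbasis_family)
  show "finite (insert None (Some ` {1..<N}))" by simp
  show "zmod.subspace (cocycles2 n lop)" by (rule subspace2)
  show "basis2 i \<in> cocycles2 n lop" for i
    by (cases i) (simp_all add: basis2_def const2_cocycle psi_cocycle)
  show "c i = 0" if "\<And>z. (\<Sum>i\<in>insert None (Some ` {1..<N}). c i * basis2 i z) = 0"
    "i \<in> insert None (Some ` {1..<N})" for c i
    using that by (rule basis2_indep)
  show "\<exists>c. \<forall>z. f z = (\<Sum>i\<in>insert None (Some ` {1..<N}). c i * basis2 i z)"
    if "f \<in> cocycles2 n lop" for f
    using that by (rule basis2_span)
qed

section \<open>The basis in degree 3\<close>

lemma finite_index3: "finite (index3 n)"
  by (rule finite_subset[of _ "laver_pairs n"]) (auto simp: index3_def finite_A)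

lemma mem_index3: "(p, q) \<in> index3 n \<longleftrightarrow> p \<in> A \<and> q \<in> A \<and> p \<noteq> pre_top"
  by (simp add: index3_def pre_top_def)

lemma phi3_apply:
  "x \<in> A \<Longrightarrow> y \<in> A \<Longrightarrow> z \<in> A \<Longrightarrow> phi3 n lop pq (x, y, z) = d3 (indicator {pq}) (x, y, z)"
  by (simp add: phi3_def cobound3_def zmap_on_def d3_def)

lemma phi3_zmaps: "phi3 n lop pq \<in> zmaps (laver_triples n)"
  by (simp add: phi3_def cobound3_def zmap_on_def zmaps_def)

lemma phi3_coboundary: "pq \<in> index3 n \<Longrightarrow> phi3 n lop pq \<in> coboundaries3 n lop"
  unfolding coboundaries3_def phi3_def
  by (intro CollectI exI[of _ "indicator {pq}"]) (auto simp: zmaps_def index3_def indicator_def)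

lemma phi3_cocycle: "phi3 n lop pq \<in> cocycles3 n lop"
proof -
  have "coc3 (d3 (indicator {pq}))" by (rule coc3_coboundary)
  then have "coc3 (phi3 n lop pq)" by (simp add: coc3_def phi3_apply)
  then show ?thesis by (simp add: cocycles3_eq phi3_zmaps)
qed

text \<open>If \<open>x = N\<close> or \<open>y = N\<close>, two of the four terms cancel. Otherwise
  the positive terms are not both one, since \<open>x \<triangleright> y > x\<close>, and if both
  negative terms are one, then \<open>x = y\<close> and the term at \<open>(x, z)\<close>
  compensates.\<close>

lemma phi3_values:
  assumes "x \<in> A" "y \<in> A" "z \<in> A"
  shows "phi3 n lop pq (x, y, z) \<in> {-1, 0, 1}"
proof -
  obtain p q where pq: "pq = (p, q)" by (cases pq)
  consider "x = N" | "x < N" "y = N" | "x < N" "y < N" using assms by (fastforce simp: mem_A)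
  then show ?thesis
  proof cases
    case 1
    then show ?thesis using assms by (auto simp: phi3_apply d3_def pq indicator_def)
  next
    case 2
    then show ?thesis using assms by (auto simp: phi3_apply d3_def pq indicator_def)
  next
    case 3
    then show ?thesis using gt_left[of x y] gt_left[of y z] assms
      by (auto simp: phi3_apply d3_def pq indicator_def)
  qed
qed

lemma sum_phi3:
  assumes "x \<in> A" "y \<in> A" "z \<in> A"
  shows "(\<Sum>i\<in>index3 n. c i * phi3 n lop i (x, y, z)) =
    d3 (\<lambda>i. if i \<in> index3 n then c i else 0) (x, y, z)"
proof -
  have delta: "(\<Sum>i\<in>index3 n. c i * indicator {i} u) = (if u \<in> index3 n then c u else 0)" for u
  proof -
    have "(\<Sum>i\<in>index3 n. c i * indicator {i} u) = (\<Sum>i\<in>index3 n. if i = u then c i else 0)"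
      by (intro sum.cong) (auto simp: indicator_def)
    then show ?thesis using finite_index3 by simp
  qed
  show ?thesis
    by (simp add: phi3_apply assms d3_def distrib_left right_diff_distrib sum.distrib sum_subtractf delta)
qed

lemma basis3_indep:
  assumes zero: "\<And>z. (\<Sum>i\<in>insert None (Some ` index3 n). c i * basis3 i z) = 0"
    and i: "i \<in> insert None (Some ` index3 n)"
  shows "c i = 0"
proof -
  define \<theta> where "\<theta> = (\<lambda>i. if i \<in> index3 n then c (Some i) else 0)"
  have sum0: "c None + d3 \<theta> (x, y, z) = 0" if "x \<in> A" "y \<in> A" "z \<in> A" for x y z
  proof -
    have "c None * const3 n (x, y, z) + (\<Sum>i\<in>index3 n. c (Some i) * phi3 n lop i (x, y, z)) = 0"
      using zero[of "(x, y, z)"] by (simp only: sum_adjoin_None finite_index3 basis3_def option.case)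
    then show ?thesis
      using that sum_phi3[OF that, of "\<lambda>i. c (Some i)"] by (simp add: const3_def zmap_on_def \<theta>_def)
  qed
  have None: "c None = 0" using sum0[of N N N] by (simp add: d3_def)
  have "coc2 \<theta>" unfolding coc2_def
  proof (intro ballI)
    fix x y z assume "x \<in> A" "y \<in> A" "z \<in> A"
    from sum0[OF this] None
    show "\<theta> (x \<triangleright> y, x \<triangleright> z) + \<theta> (x, z) = \<theta> (x, y \<triangleright> z) + \<theta> (y, z)" by (simp add: d3_def)
  qed
  \<comment> \<open>Row \<open>pre_top\<close> of \<open>\<theta>\<close> is zero because
    \<open>index3\<close> omits it.\<close>
  then have zero: "\<theta> (x, y) = 0" if "x \<in> A" "y \<in> A" for x y
    by (rule coc2_zero_row) (use that in \<open>auto simp: \<theta>_def mem_index3\<close>)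
  have "c (Some (p, q)) = 0" if "(p, q) \<in> index3 n" for p q
    using zero[of p q] that by (simp add: \<theta>_def mem_index3)
  then show ?thesis using i None by auto
qed

lemma basis3_span:
  assumes "\<phi> \<in> cocycles3 n lop"
  shows "\<exists>c. \<forall>z. \<phi> z = (\<Sum>i\<in>insert None (Some ` index3 n). c i * basis3 i z)"
proof -
  have "coc3 \<phi>" using assms by (simp add: cocycles3_eq)
  then obtain \<theta> where \<theta>: "\<And>x y z. x \<in> A \<Longrightarrow> y \<in> A \<Longrightarrow> z \<in> A \<Longrightarrow>
      \<phi> (x, y, z) = \<phi> (N, N, 1) + d3 \<theta> (x, y, z)" "\<And>y. y \<in> A \<Longrightarrow> \<theta> (pre_top, y) = 0"
    using coc3_form_reduced by metis
  define d where "d = case_option (\<phi> (N, N, 1)) \<theta>"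
  \<comment> \<open>The reduced \<open>\<theta>\<close> is zero on the omitted row, so restricting
    it to \<open>index3\<close> loses nothing on the table.\<close>
  have \<theta>': "(if (x, y) \<in> index3 n then \<theta> (x, y) else 0) = \<theta> (x, y)" if "x \<in> A" "y \<in> A" for x y
    using that \<theta>(2) by (auto simp: mem_index3)
  have "\<phi> w = (\<Sum>i\<in>insert None (Some ` index3 n). d i * basis3 i w)" for w
  proof (cases "w \<in> laver_triples n")
    case True
    then obtain x y z where w: "w = (x, y, z)" "x \<in> A" "y \<in> A" "z \<in> A" by auto
    have "\<phi> w = \<phi> (N, N, 1) + d3 \<theta> (x, y, z)" using \<theta>(1)[OF w(2-4)] w(1) by simp
    also have "d3 \<theta> (x, y, z) = (\<Sum>i\<in>index3 n. \<theta> i * phi3 n lop i (x, y, z))"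
      unfolding sum_phi3[OF w(2-4)] using w(2-4) by (simp add: d3_def \<theta>')
    finally show ?thesis
      using w by (subst sum_adjoin_None) (simp_all add: finite_index3 basis3_def d_def const3_def zmap_on_def)
  next
    case False
    then have "\<phi> w = 0" "phi3 n lop i w = 0" for i
      using assms phi3_zmaps[of i] unfolding cocycles3_def zmaps_def by blast+
    then show ?thesis
      using False by (subst sum_adjoin_None) (simp_all add: finite_index3 basis3_def const3_def zmap_on_def)
  qed
  then show ?thesis by blast
qed

lemma basis3_zbasis:
  "inj_on basis3 (insert None (Some ` index3 n)) \<and>
   zbasis (cocycles3 n lop) (basis3 ` insert None (Some ` index3 n))"
proof (rule zbasis_family)
  show "finite (insert None (Some ` index3 n))" by (simp add: finite_index3)
  show "zmod.subspace (cocycles3 n lop)" by (rule subspace3)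
  show "basis3 i \<in> cocycles3 n lop" for i
    by (cases i) (simp_all add: basis3_def const3_cocycle phi3_cocycle)
  show "c i = 0" if "\<And>z. (\<Sum>i\<in>insert None (Some ` index3 n). c i * basis3 i z) = 0"
    "i \<in> insert None (Some ` index3 n)" for c i
    using that by (rule basis3_indep)
  show "\<exists>c. \<forall>z. f z = (\<Sum>i\<in>insert None (Some ` index3 n). c i * basis3 i z)"
    if "f \<in> cocycles3 n lop" for f
    using that by (rule basis3_span)
qed

lemma card_index3: "card (index3 n) = 2 ^ (2 * n) - 2 ^ n"
proof -
  have "index3 n = (A - {pre_top}) \<times> A" by (auto simp: mem_index3)
  then have "card (index3 n) = (N - 1) * N"
    using pre_top_in finite_A by (simp add: card_cartesian_product laver_set_def)
  then show ?thesis by (simp add: diff_mult_distrib mult_2 power_add)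
qed

end

lemma adjoin_None_family:
  assumes "inj_on (case_option b f) (insert None (Some ` J))"
  shows "inj_on f J" "b \<notin> f ` J" "case_option b f ` insert None (Some ` J) = insert b (f ` J)"
proof -
  show "inj_on f J" using assms by (fastforce simp: inj_on_def)
  show "b \<notin> f ` J"
  proof
    assume "b \<in> f ` J"
    then obtain j where "j \<in> J" "b = f j" by auto
    then show False using inj_onD[OF assms, of None "Some j"] by simp
  qed
  show "case_option b f ` insert None (Some ` J) = insert b (f ` J)" by force
qed

theorem theoremA:
  fixes n :: nat and lop :: "nat \<Rightarrow> nat \<Rightarrow> nat"
  assumes "laver_table n lop"
  shows "(zfree_of_rank (cocycles2 n lop) (2 ^ n) \<and>
          (\<forall>q\<in>{1..<2 ^ n}. psi n lop q \<in> coboundaries2 n lop \<and>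
             (\<forall>z\<in>laver_pairs n. psi n lop q z \<in> {0, 1})) \<and>
          inj_on (psi n lop) {1..<2 ^ n} \<and>
          card (psi n lop ` {1..<2 ^ n}) = 2 ^ n - 1 \<and>
          const2 n \<notin> psi n lop ` {1..<2 ^ n} \<and>
          zbasis (cocycles2 n lop) (insert (const2 n) (psi n lop ` {1..<2 ^ n})))
       \<and> (zfree_of_rank (cocycles3 n lop) (2 ^ (2 * n) - 2 ^ n + 1) \<and>
          (\<forall>pq\<in>index3 n. phi3 n lop pq \<in> coboundaries3 n lop \<and>
             (\<forall>z\<in>laver_triples n. phi3 n lop pq z \<in> {-1, 0, 1})) \<and>
          inj_on (phi3 n lop) (index3 n) \<and>
          card (phi3 n lop ` index3 n) = 2 ^ (2 * n) - 2 ^ n \<and>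
          const3 n \<notin> phi3 n lop ` index3 n \<and>
          zbasis (cocycles3 n lop) (insert (const3 n) (phi3 n lop ` index3 n)))"
proof -
  interpret laver n lop by unfold_locales (rule assms)
  note b2 = basis2_zbasis[unfolded basis2_def] and b3 = basis3_zbasis[unfolded basis3_def]
  note a2 = adjoin_None_family[OF conjunct1[OF b2]] and a3 = adjoin_None_family[OF conjunct1[OF b3]]
  have z2: "zbasis (cocycles2 n lop) (insert (const2 n) (psi n lop ` {1..<2 ^ n}))"
    using conjunct2[OF b2] unfolding a2(3) .
  have z3: "zbasis (cocycles3 n lop) (insert (const3 n) (phi3 n lop ` index3 n))"
    using conjunct2[OF b3] unfolding a3(3) .
  have c2: "card (psi n lop ` {1..<2 ^ n}) = 2 ^ n - 1" using card_image[OF a2(1)] by simp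
  have c3: "card (phi3 n lop ` index3 n) = 2 ^ (2 * n) - 2 ^ n"
    using card_image[OF a3(1)] card_index3 by simp
  have "card (insert (const2 n) (psi n lop ` {1..<2 ^ n})) = 2 ^ n" using c2 a2(2) by simp
  then have r2: "zfree_of_rank (cocycles2 n lop) (2 ^ n)"
    unfolding zfree_of_rank_def using z2 by blast
  have "card (insert (const3 n) (phi3 n lop ` index3 n)) = 2 ^ (2 * n) - 2 ^ n + 1"
    using c3 a3(2) finite_index3 by simp
  then have r3: "zfree_of_rank (cocycles3 n lop) (2 ^ (2 * n) - 2 ^ n + 1)"
    unfolding zfree_of_rank_def using z3 finite_index3 by blast
  have v2: "psi n lop q z \<in> {0, 1}" for q z by (cases z) (simp add: psi_def zmap_on_def)
  have v3: "phi3 n lop pq z \<in> {-1, 0, 1}" if "z \<in> laver_triples n" for pq z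
    using that phi3_values by (cases z) blast
  show ?thesis
    using r2 r3 z2 z3 c2 c3 a2(1,2) a3(1,2) v2 v3 psi_coboundary phi3_coboundary by blast
qed

end
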